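(* Let $T$ be a tree of order $n\ge 9$. If $T\not\cong F_n$, then $d(T)\le h(n)$, and equality holds if and only if $T\cong T_n$, where \[ h(n)=\begin{cases}2^{n-1}+(n+9)\cdot 2^{\frac{n-7}{2}} & n \text{ odd},\\ 2^{n-1}+(n+12)\cdot 2^{\frac{n-8}{2}} & n\text{ even},\end{cases}\qquad F_n=\begin{cases}K_1*\tfrac{n-1}{2}K_2 & n\text{ odd},\\ K_2*\tfrac{n-2}{2}K_2 & n\text{ even},\end{cases}\] \[ T_n=\begin{cases}K_1*\big(2K_1\cup \tfrac{n-3}{2}K_2\big) & n\text{ odd},\\ K_1*\big(3K_1\cup\tfrac{n-4}{2}K_2\big) & n\text{ even}.\end{cases}\]
   Context: All graphs are finite, simple and undirected. A subset $S$ of vertices of a graph $G$ is a dissociation set if the subgraph induced by $S$ has maximum degree at most one (the empty set is a dissociation set). $d(G)$ denotes the total number of dissociation sets of $G$ (including the empty set). $sK_1\cup tK_2$ denotes the disjoint union of $s$ isolated vertices and $t$ disjoint edges; $tK_2$ is the disjoint union of $t$ edges. The operation $*$: if $H=K_{s_1}\cup\cdots\cup K_{s_t}$ is a disjoint union of complete graphs and $K_r$ is a complete graph disjoint from $H$, then $K_r*H$ is the graph obtained from $K_r\cup H$ by choosing one vertex $u$ of $K_r$ and joining $u$ to exactly one vertex of each component of $H$ (the result is independent of choices up to isomorphism). *)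

theory Defs
  imports "Graph_Theory.Graph_Theory"
begin

text \<open>
  Finite simple undirected graphs are the symmetric loop-free digraphs \<open>pair_graph\<close>. The degree of
  a vertex of such a graph is its out-degree (equivalently its in-degree).

  The library's \<open>tree\<close> is not the undirected notion: in a symmetric digraph both
  orientations of a single edge already form a cycle of length 2. The cycles of the undirected
  graph are the directed cycles of length at least 3.
\<close>

definition undirected_tree :: "('a, 'b) pre_digraph \<Rightarrow> bool" where
  "undirected_tree G \<longleftrightarrow> connected G \<and> \<not> (\<exists>p. pre_digraph.cycle G p \<and> 3 \<le> length p)"

definition dissociation_set :: "('a, 'b) pre_digraph \<Rightarrow> 'a set \<Rightarrow> bool" where
  "dissociation_set G S \<longleftrightarrow>
     S \<subseteq> verts G \<and> (\<forall>v \<in> verts (G \<restriction> S). out_degree (G \<restriction> S) v \<le> 1)"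

definition num_dissociation_sets :: "('a, 'b) pre_digraph \<Rightarrow> nat" where
  "num_dissociation_sets G = card {S. dissociation_set G S}"

text \<open>
  The disjoint union of complete graphs whose orders are listed in \<open>ss\<close>; the vertex \<open>(i, j)\<close> is
  the \<open>j\<close>-th vertex of the \<open>i\<close>-th component.
\<close>

definition clique_union :: "nat list \<Rightarrow> (nat \<times> nat) pair_pre_digraph" where
  "clique_union ss =
     \<lparr> pverts = {(i, j). i < length ss \<and> j < ss ! i},
       parcs = {((i, j), (i, k)) | i j k. i < length ss \<and> j < ss ! i \<and> k < ss ! i \<and> j \<noteq> k} \<rparr>"

text \<open>
  \<open>clique_star r ss\<close> is \<open>K_r * H\<close>, where \<open>H\<close> is the disjoint union of the complete graphs of
  orders \<open>ss\<close> (\<open>r\<close> and all entries of \<open>ss\<close> positive). Component 0 is \<open>K_r\<close>; its chosen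
  vertex is \<open>(0, 0)\<close>, and \<open>(i, 0)\<close> is the vertex chosen in the \<open>i\<close>-th component of \<open>H\<close>.
\<close>

definition clique_star :: "nat \<Rightarrow> nat list \<Rightarrow> (nat \<times> nat) pair_pre_digraph" where
  "clique_star r ss =
     \<lparr> pverts = pverts (clique_union (r # ss)),
       parcs = parcs (clique_union (r # ss))
         \<union> {((0, 0), (i, 0)) | i. 1 \<le> i \<and> i \<le> length ss}
         \<union> {((i, 0), (0, 0)) | i. 1 \<le> i \<and> i \<le> length ss} \<rparr>"

definition F_graph :: "nat \<Rightarrow> (nat \<times> nat) pair_pre_digraph" where
  "F_graph n = (if odd n then clique_star 1 (replicate ((n - 1) div 2) 2)
                else clique_star 2 (replicate ((n - 2) div 2) 2))"

definition T_graph :: "nat \<Rightarrow> (nat \<times> nat) pair_pre_digraph" where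
  "T_graph n = (if odd n then clique_star 1 (replicate 2 1 @ replicate ((n - 3) div 2) 2)
                else clique_star 1 (replicate 3 1 @ replicate ((n - 4) div 2) 2))"

definition h :: "nat \<Rightarrow> nat" where
  "h n = (if odd n then 2 ^ (n - 1) + (n + 9) * 2 ^ ((n - 7) div 2)
          else 2 ^ (n - 1) + (n + 12) * 2 ^ ((n - 8) div 2))"

lemma finite_pverts_clique_union: "finite (pverts (clique_union ss))"
proof -
  have "pverts (clique_union ss) = (SIGMA i:{..<length ss}. {..<ss ! i})"
    by (auto simp: clique_union_def)
  then show ?thesis by simp
qed

lemma card_pverts_clique_star: "card (pverts (clique_star r ss)) = r + sum_list ss"
proof -
  have "pverts (clique_star r ss) = (SIGMA i:{..<length (r # ss)}. {..<(r # ss) ! i})"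
    by (auto simp: clique_star_def clique_union_def)
  then have "card (pverts (clique_star r ss)) = (\<Sum>i<length (r # ss). (r # ss) ! i)"
    by (simp del: length_Cons)
  also have "\<dots> = sum_list (r # ss)"
    by (simp only: sum_list_sum_nth atLeast0LessThan)
  finally show ?thesis by simp
qed

lemma pair_graph_clique_star:
  assumes "0 < r" and "\<And>s. s \<in> set ss \<Longrightarrow> 0 < s"
  shows "pair_graph (clique_star r ss)"
proof -
  have pos: "0 < (r # ss) ! i" if "i \<le> length ss" for i
    using assms that by (cases i) auto
  have sub: "parcs (clique_star r ss) \<subseteq> pverts (clique_star r ss) \<times> pverts (clique_star r ss)"
    using pos assms(1) by (auto simp: clique_star_def clique_union_def less_Suc_eq_le)
  have fin: "finite (pverts (clique_star r ss))"
    by (simp add: clique_star_def finite_pverts_clique_union)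
  show ?thesis
  proof unfold_locales
    show "symmetric (with_proj (clique_star r ss))"
      by (auto simp: symmetric_def sym_def clique_star_def clique_union_def)
    show "finite (parcs (clique_star r ss))"
      using sub fin by (meson finite_SigmaI finite_subset)
  qed (use sub fin in \<open>auto simp: clique_star_def clique_union_def\<close>)
qed

lemma card_pverts_F_graph: "2 \<le> n \<Longrightarrow> card (pverts (F_graph n)) = n"
  by (auto simp: F_graph_def card_pverts_clique_star sum_list_replicate)

lemma card_pverts_T_graph: "4 \<le> n \<Longrightarrow> card (pverts (T_graph n)) = n"
  by (auto simp: T_graph_def card_pverts_clique_star sum_list_replicate)

lemma pair_graph_F_graph: "pair_graph (F_graph n)"
  unfolding F_graph_def by (auto intro!: pair_graph_clique_star)

lemma pair_graph_T_graph: "pair_graph (T_graph n)"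
  unfolding T_graph_def by (auto intro!: pair_graph_clique_star)

end

theory Submission
  imports Defs
begin

text \<open>
  For a tree with root \<open>r\<close>, count the dissociation sets that contain \<open>r\<close>, that avoid \<open>r\<close>, and in
  which \<open>r\<close> is an isolated vertex. Joining two rooted trees by an edge between their roots acts on
  these triples by a bilinear, monotone operation, and deleting a leaf other than the root at most
  halves each entry.

  Call a tree a spider if some vertex leaves only components of order at most two when it is
  deleted. A spider with \<open>s\<close> short and \<open>t\<close> long legs has
  \<open>2 ^ (n - 1) + (2 * s + t + 2) * 2 ^ t / 2\<close> dissociation sets; this decreases when a long leg is
  traded for two short ones, so \<open>F_n\<close> and then \<open>T_n\<close> come first among the spiders. A tree of order at
  least seven that is not a spider has a vertex with three branches, one of order at least three, or
  with two branches of order at least three. Combining the few maximal triples of order at most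
  eight bounds such trees of order 9, 10 and 11 below \<open>h n\<close>, and by \<open>2 ^ 10\<close> for order 11. By the
  halving property the bound \<open>2 ^ (n - 1) < h n\<close> then holds for all \<open>n \<ge> 11\<close>.
\<close>

section \<open>Rooted trees and spiders\<close>

definition link :: "'a rel \<Rightarrow> 'a \<Rightarrow> 'a rel \<Rightarrow> 'a \<Rightarrow> 'a rel" where
  "link E r F s = E \<union> F \<union> {(r, s), (s, r)}"

text \<open>Binary joining at the roots, rather than a root with a list of branches, matches the
  bilinear recursion for the counts; branches of the root are recovered by splitting.\<close>

inductive rtree :: "'a set \<Rightarrow> 'a rel \<Rightarrow> 'a \<Rightarrow> bool" where
  single: "rtree {r} {} r"
| join: "rtree V E r \<Longrightarrow> rtree W F s \<Longrightarrow> V \<inter> W = {} \<Longrightarrow> rtree (V \<union> W) (link E r F s) r"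

lemma link_commute: "link E r F s = link F s E r"
  by (auto simp: link_def)

lemma rtree_finite: "rtree V E r \<Longrightarrow> finite V"
  by (induction rule: rtree.induct) auto

lemma rtree_root: "rtree V E r \<Longrightarrow> r \<in> V"
  by (induction rule: rtree.induct) auto

lemma rtree_edges: "rtree V E r \<Longrightarrow> E \<subseteq> V \<times> V"
proof (induction rule: rtree.induct)
  case (join V E r W F s)
  then show ?case by (auto simp: link_def dest: rtree_root)
qed simp

lemma rtree_card_pos: "rtree V E r \<Longrightarrow> 0 < card V"
  using rtree_finite[of V E r] rtree_root[of V E r] by (auto simp: card_gt_0_iff)

text \<open>An edge added at \<open>u\<close> commutes with the join at the root, so the new tree is
  pushed into whichever of the two parts contains \<open>u\<close>.\<close>

lemma rtree_attach:
  assumes "rtree V E r" "u \<in> V" "rtree W F s" "V \<inter> W = {}"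
  shows "rtree (V \<union> W) (link E u F s) r"
  using assms
proof (induction arbitrary: u rule: rtree.induct)
  case (single r)
  then show ?case using rtree.join[OF rtree.single, of W F s r] by simp
next
  case (join V1 E1 r1 V2 E2 r2)
  show ?case
  proof (cases "u \<in> V1")
    case True
    have "rtree ((V1 \<union> W) \<union> V2) (link (link E1 u F s) r1 E2 r2) r1"
      using join.IH(1)[OF True join.prems(2)] join.hyps join.prems by (intro rtree.join) auto
    moreover have "link (link E1 u F s) r1 E2 r2 = link (link E1 r1 E2 r2) u F s"
      by (auto simp: link_def)
    ultimately show ?thesis by (simp add: Un_ac)
  next
    case False
    have "rtree (V1 \<union> (V2 \<union> W)) (link E1 r1 (link E2 u F s) r2) r1"
      using join.IH(2)[of u] False join.hyps join.prems by (intro rtree.join) auto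
    moreover have "link E1 r1 (link E2 u F s) r2 = link (link E1 r1 E2 r2) u F s"
      by (auto simp: link_def)
    ultimately show ?thesis by (simp add: Un_ac)
  qed
qed

lemma rtree_singleton: "rtree V E r \<Longrightarrow> card V = 1 \<Longrightarrow> V = {r} \<and> E = {}"
proof (induction rule: rtree.induct)
  case (join V E r W F s)
  then show ?case
    using rtree_finite[OF join(1)] rtree_finite[OF join(2)]
      rtree_card_pos[OF join(1)] rtree_card_pos[OF join(2)]
    by (simp add: card_Un_disjoint)
qed simp

lemma rtree_split:
  assumes "rtree V E r" "2 \<le> card V"
  obtains A EA B EB s where "rtree A EA r" "rtree B EB s" "A \<inter> B = {}"
    "V = A \<union> B" "E = link EA r EB s" "card V = card A + card B"
  using assms
proof (cases rule: rtree.cases)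
  case (join A EA B EB s)
  then show ?thesis using that rtree_finite card_Un_disjoint by metis
qed auto

inductive spider :: "'a set \<Rightarrow> 'a rel \<Rightarrow> 'a \<Rightarrow> nat \<Rightarrow> nat \<Rightarrow> bool" where
  center: "spider {r} {} r 0 0"
| short_leg: "spider V E r s t \<Longrightarrow> b \<notin> V \<Longrightarrow> spider (V \<union> {b}) (link E r {} b) r (Suc s) t"
| long_leg: "spider V E r s t \<Longrightarrow> b \<notin> V \<Longrightarrow> c \<notin> V \<Longrightarrow> b \<noteq> c \<Longrightarrow>
    spider (V \<union> {b, c}) (link E r {(b, c), (c, b)} b) r s (Suc t)"

lemma rtree_pair: "b \<noteq> c \<Longrightarrow> rtree {b, c} {(b, c), (c, b)} b"
  using rtree.join[OF rtree.single rtree.single, of b c] by (simp add: link_def insert_commute)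

lemma spider_rtree: "spider V E r s t \<Longrightarrow> rtree V E r"
proof (induction rule: spider.induct)
  case (short_leg V E r s t b)
  then show ?case by (intro rtree.join rtree.single) auto
next
  case (long_leg V E r s t b c)
  then show ?case by (intro rtree.join rtree_pair) auto
qed (rule rtree.single)

lemma rtree_two:
  assumes "rtree V E r" "card V = 2"
  shows "\<exists>c. c \<noteq> r \<and> V = {r, c} \<and> E = {(r, c), (c, r)}"
proof -
  obtain A EA B EB s where *: "rtree A EA r" "rtree B EB s" "A \<inter> B = {}" "V = A \<union> B"
    "E = link EA r EB s" "card V = card A + card B"
    using rtree_split[OF assms(1)] assms(2) by (metis order_refl)
  then have "card A = 1" "card B = 1"
    using assms(2) rtree_card_pos[OF *(1)] rtree_card_pos[OF *(2)] by linarith+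
  then have "A = {r}" "EA = {}" "B = {s}" "EB = {}"
    using rtree_singleton[OF *(1)] rtree_singleton[OF *(2)] by auto
  then show ?thesis using * by (auto simp: link_def)
qed

section \<open>The dichotomy between spiders and broad trees\<close>

lemma spider_join_small:
  assumes "spider V E r s t" "rtree W F b" "V \<inter> W = {}" "card W \<le> 2"
  shows "\<exists>s t. spider (V \<union> W) (link E r F b) r s t"
proof -
  consider "card W = 1" | "card W = 2"
    using assms(4) rtree_card_pos[OF assms(2)] by linarith
  then show ?thesis
  proof cases
    case 1
    then have W: "W = {b}" "F = {}" using rtree_singleton[OF assms(2)] by auto
    then have "spider (V \<union> W) (link E r F b) r (Suc s) t"
      using assms(1,3) unfolding W by (intro spider.short_leg) auto
    then show ?thesis by blast
  next
    case 2
    then obtain c where W: "c \<noteq> b" "W = {b, c}" "F = {(b, c), (c, b)}"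
      using rtree_two[OF assms(2)] by blast
    have "spider (V \<union> W) (link E r F b) r s (Suc t)"
      using assms(1,3) W(1) unfolding W(2,3) by (intro spider.long_leg) auto
    then show ?thesis by blast
  qed
qed

text \<open>Branches of order at most two extend a spider centred at the root. Once a branch
  \<open>B\<close> of order at least three has occurred, later joins are reordered so that
  \<open>B\<close> is attached last.\<close>

lemma rtree_spider_or_long_branch:
  assumes "rtree V E r"
  shows "(\<exists>s t. spider V E r s t) \<or>
    (\<exists>A EA B EB u. rtree A EA r \<and> rtree B EB u \<and> A \<inter> B = {} \<and> 3 \<le> card B
      \<and> V = A \<union> B \<and> E = link EA r EB u)"
  using assms
proof (induction rule: rtree.induct)
  case (single r)
  then show ?case using spider.center by fast
next
  case (join V E r W F b)
  show ?case
  proof (cases "3 \<le> card W")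
    case True
    then show ?thesis using join.hyps by blast
  next
    case False
    then have small: "card W \<le> 2" by simp
    from join.IH(1) show ?thesis
    proof (elim disjE exE conjE)
      fix s t assume "spider V E r s t"
      then show ?thesis using spider_join_small[OF _ join.hyps(2,3) small] by blast
    next
      fix A EA B EB u
      assume *: "rtree A EA r" "rtree B EB u" "A \<inter> B = {}" "3 \<le> card B" "V = A \<union> B"
        "E = link EA r EB u"
      have "rtree (A \<union> W) (link EA r F b) r" using * join.hyps by (intro rtree.join) auto
      moreover have "V \<union> W = (A \<union> W) \<union> B" "link E r F b = link (link EA r F b) r EB u"
        using * by (auto simp: link_def)
      moreover have "(A \<union> W) \<inter> B = {}" using * join.hyps by blast
      ultimately show ?thesis using *(2,4) by blast
    qed
  qed
qed

text \<open>The two shapes are chosen so that no spider of order at least seven has such a vertex: the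
  estimates for broad trees below would be false if spiders were included.\<close>

inductive broad :: "'a set \<Rightarrow> 'a rel \<Rightarrow> 'a \<Rightarrow> bool" where
  three_branches: "rtree R E r \<Longrightarrow> rtree A EA a \<Longrightarrow> rtree B EB b \<Longrightarrow> rtree C EC c \<Longrightarrow>
    R \<inter> A = {} \<Longrightarrow> (R \<union> A) \<inter> B = {} \<Longrightarrow> (R \<union> A \<union> B) \<inter> C = {} \<Longrightarrow> 3 \<le> card A \<Longrightarrow>
    broad (R \<union> A \<union> B \<union> C) (link (link (link E r EA a) r EB b) r EC c) r"
| two_branches: "rtree R E r \<Longrightarrow> rtree A EA a \<Longrightarrow> rtree B EB b \<Longrightarrow>
    R \<inter> A = {} \<Longrightarrow> (R \<union> A) \<inter> B = {} \<Longrightarrow> 3 \<le> card A \<Longrightarrow> 3 \<le> card B \<Longrightarrow>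
    broad (R \<union> A \<union> B) (link (link E r EA a) r EB b) r"

text \<open>If one of the branches has order at least three, it is moved to the front. Otherwise
  either \<open>R\<close> is a spider and absorbs all three as legs, or \<open>R\<close> itself
  contains a long branch.\<close>

lemma spider_or_broad_if_three_branches:
  assumes "rtree R E r" "rtree A EA a" "rtree B EB b" "rtree C EC c"
    "R \<inter> A = {}" "(R \<union> A) \<inter> B = {}" "(R \<union> A \<union> B) \<inter> C = {}"
  defines "V \<equiv> R \<union> A \<union> B \<union> C" and "F \<equiv> link (link (link E r EA a) r EB b) r EC c"
  shows "(\<exists>s t. spider V F r s t) \<or> broad V F r"
proof -
  have 1: ?thesis if "3 \<le> card A"
    using three_branches[OF assms(1-7) that] by (simp add: V_def F_def)
  have 2: ?thesis if "3 \<le> card B"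
  proof -
    have "broad (R \<union> B \<union> A \<union> C) (link (link (link E r EB b) r EA a) r EC c) r"
      by (rule three_branches) (use assms(1-7) that in auto)
    moreover have "link (link (link E r EB b) r EA a) r EC c = F"
      by (auto simp: link_def F_def)
    ultimately show ?thesis by (simp add: V_def Un_ac)
  qed
  have 3: ?thesis if "3 \<le> card C"
  proof -
    have "broad (R \<union> C \<union> A \<union> B) (link (link (link E r EC c) r EA a) r EB b) r"
      by (rule three_branches) (use assms(1-7) that in auto)
    moreover have "link (link (link E r EC c) r EA a) r EB b = F"
      by (auto simp: link_def F_def)
    ultimately show ?thesis by (simp add: V_def Un_ac)
  qed
  have 4: ?thesis if small: "card A \<le> 2" "card B \<le> 2" "card C \<le> 2"
    using rtree_spider_or_long_branch[OF assms(1)]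
  proof (elim disjE exE conjE)
    fix s t assume "spider R E r s t"
    then obtain s' t' where "spider (R \<union> A) (link E r EA a) r s' t'"
      using spider_join_small[OF _ assms(2,5) small(1)] by blast
    then obtain s' t' where "spider (R \<union> A \<union> B) (link (link E r EA a) r EB b) r s' t'"
      using spider_join_small[OF _ assms(3,6) small(2)] by blast
    then show ?thesis
      using spider_join_small[OF _ assms(4,7) small(3)] unfolding V_def F_def by blast
  next
    fix R' E' D ED d
    assume *: "rtree R' E' r" "rtree D ED d" "R' \<inter> D = {}" "3 \<le> card D" "R = R' \<union> D"
        "E = link E' r ED d"
    \<comment> \<open>The long branch \<open>D\<close> inside \<open>R\<close> takes the place of
      \<open>A\<close>, which is absorbed into the part at the root; \<open>B\<close> and
      \<open>C\<close> remain as the other branches.\<close>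
    have "rtree (R' \<union> A) (link E' r EA a) r" by (rule rtree.join) (use assms(1-7) * in auto)
    then have "broad (R' \<union> A \<union> D \<union> B \<union> C) (link (link (link (link E' r EA a) r ED d) r EB b) r EC c) r"
      by (rule three_branches) (use assms(1-7) * in auto)
    moreover have "link (link (link (link E' r EA a) r ED d) r EB b) r EC c = F"
      by (auto simp: link_def F_def *)
    moreover have "R' \<union> A \<union> D \<union> B \<union> C = V" by (auto simp: V_def *)
    ultimately show ?thesis by simp
  qed
  consider "3 \<le> card A" | "3 \<le> card B" | "3 \<le> card C"
    | "card A \<le> 2" "card B \<le> 2" "card C \<le> 2" by linarith
  then show ?thesis using 1 2 3 4 by cases
qed

text \<open>The root moves across the edge from \<open>r\<close> to \<open>u\<close>. If
  \<open>B\<close> has two or more branches at \<open>u\<close>, then \<open>u\<close> carries three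
  branches, \<open>R\<close> among them. If it has only \<open>B'\<close>, then \<open>u\<close> has
  degree two and the edge to \<open>B'\<close> is the next one to cross.\<close>

lemma spider_or_broad_step:
  assumes "rtree R E r" "rtree B F u" "R \<inter> B = {}" "2 \<le> card B"
  defines "V \<equiv> R \<union> B" and "G \<equiv> link E r F u"
  shows "(\<exists>s t. spider V G u s t) \<or> broad V G u \<or>
    (\<exists>B' F' u'. rtree ({u} \<union> R) (link {} u E r) u \<and> rtree B' F' u' \<and> ({u} \<union> R) \<inter> B' = {}
      \<and> card B = Suc (card B') \<and> V = ({u} \<union> R) \<union> B' \<and> G = link (link {} u E r) u F' u')"
proof -
  obtain A EA B' F' u' where *: "rtree A EA u" "rtree B' F' u'" "A \<inter> B' = {}"
    "B = A \<union> B'" "F = link EA u F' u'" "card B = card A + card B'"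
    using rtree_split[OF assms(2,4)] by metis
  have disj: "R \<inter> A = {}" "R \<inter> B' = {}" using assms(3) *(4) by auto
  show ?thesis
  proof (cases "card A = 1")
    case True
    then have A: "A = {u}" "EA = {}" using rtree_singleton[OF *(1)] by auto
    have "rtree ({u} \<union> R) (link {} u E r) u"
      using rtree.join[OF rtree.single assms(1), of u] disj(1) A(1) by blast
    moreover have "G = link (link {} u E r) u F' u'"
      unfolding G_def *(5) A(2) by (auto simp: link_def)
    moreover have "({u} \<union> R) \<inter> B' = {}" using *(3) disj(2) A(1) by blast
    moreover have "V = ({u} \<union> R) \<union> B'" unfolding V_def *(4) A(1) by blast
    moreover have "card B = Suc (card B')" using *(6) True by linarith
    ultimately show ?thesis using *(2) by blast
  next
    case False
    then have "2 \<le> card A" using rtree_card_pos[OF *(1)] by linarith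
    then obtain C EC D ED d where **: "rtree C EC u" "rtree D ED d" "C \<inter> D = {}"
      "A = C \<union> D" "EA = link EC u ED d"
      using rtree_split[OF *(1)] by metis
    have "(C \<union> D) \<inter> B' = {}" "(C \<union> D \<union> B') \<inter> R = {}"
      using *(3) **(4) disj by auto
    note spider_or_broad_if_three_branches[OF **(1,2) *(2) assms(1) **(3) this]
    moreover have "C \<union> D \<union> B' \<union> R = V" unfolding V_def *(4) **(4) by blast
    moreover have "link (link (link EC u ED d) u F' u') u E r = G"
      unfolding G_def *(5) **(5) by (rule link_commute)
    ultimately show ?thesis by auto
  qed
qed

text \<open>Walking away from \<open>R\<close>, each step either finishes or moves one vertex from
  \<open>B\<close> to the side of \<open>R\<close>. The walk stops at the latest when
  \<open>R\<close> has three vertices, since then \<open>u\<close> separates two branches of order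
  at least three.\<close>

lemma spider_or_broad_grow:
  assumes "rtree R E r" "rtree B F u" "R \<inter> B = {}" "4 \<le> card B" "7 \<le> card R + card B"
  shows "\<exists>v. (\<exists>s t. spider (R \<union> B) (link E r F u) v s t) \<or> broad (R \<union> B) (link E r F u) v"
  using assms
proof (induction "3 - card R" arbitrary: R E r B F u rule: less_induct)
  case less
  have step: "(\<exists>s t. spider (R \<union> B) (link E r F u) u s t) \<or> broad (R \<union> B) (link E r F u) u \<or>
    (\<exists>B' F' u'. rtree ({u} \<union> R) (link {} u E r) u \<and> rtree B' F' u' \<and> ({u} \<union> R) \<inter> B' = {}
      \<and> card B = Suc (card B') \<and> R \<union> B = ({u} \<union> R) \<union> B' \<and> link E r F u = link (link {} u E r) u F' u')"
    by (rule spider_or_broad_step) (use less.prems in auto)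
  then show ?case
  proof (elim disjE)
    assume "\<exists>B' F' u'. rtree ({u} \<union> R) (link {} u E r) u \<and> rtree B' F' u' \<and> ({u} \<union> R) \<inter> B' = {}
      \<and> card B = Suc (card B') \<and> R \<union> B = ({u} \<union> R) \<union> B' \<and> link E r F u = link (link {} u E r) u F' u'"
    then obtain B' F' u' where
      *: "rtree ({u} \<union> R) (link {} u E r) u" "rtree B' F' u'" "({u} \<union> R) \<inter> B' = {}"
      "card B = Suc (card B')" "R \<union> B = ({u} \<union> R) \<union> B'"
      "link E r F u = link (link {} u E r) u F' u'" by blast
    have u: "u \<notin> R" using less.prems(3) rtree_root[OF less.prems(2)] by blast
    have B': "3 \<le> card B'" using *(4) less.prems(4) by linarith
    have "\<exists>v. (\<exists>s t. spider (({u} \<union> R) \<union> B') (link (link {} u E r) u F' u') v s t)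
      \<or> broad (({u} \<union> R) \<union> B') (link (link {} u E r) u F' u') v"
    proof (cases "3 \<le> card R")
      case True
      have "broad ({u} \<union> R \<union> B') (link (link {} u E r) u F' u') u"
        using two_branches[OF rtree.single less.prems(1) *(2) _ *(3) True B'] u by blast
      then show ?thesis by blast
    next
      case False
      moreover have "card ({u} \<union> R) = Suc (card R)" using u rtree_finite[OF less.prems(1)] by simp
      \<comment> \<open>As \<open>card R \<le> 2\<close> and the total is at least 7, at least four
        vertices remain in \<open>B'\<close>.\<close>
      ultimately have "3 - card ({u} \<union> R) < 3 - card R" "4 \<le> card B'"
        "7 \<le> card ({u} \<union> R) + card B'"
        using *(4) less.prems(5) by linarith+
      then show ?thesis using less.hyps[OF _ *(1-3)] by blast
    qed
    then show ?thesis unfolding *(5,6) .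
  qed blast+
qed

lemma spider_or_broad:
  assumes "rtree V E r" "7 \<le> card V"
  shows "\<exists>v. (\<exists>s t. spider V E v s t) \<or> broad V E v"
proof -
  have "2 \<le> card V" using assms(2) by linarith
  then obtain A EA B EB u where *: "rtree A EA r" "rtree B EB u" "A \<inter> B = {}"
    "V = A \<union> B" "E = link EA r EB u" "card V = card A + card B"
    using rtree_split[OF assms(1)] by metis
  \<comment> \<open>Of seven vertices at least four lie on one side of the edge; the walk heads for
    that side.\<close>
  consider "4 \<le> card A" | "4 \<le> card B" using assms(2) *(6) by linarith
  then show ?thesis
  proof cases
    case 1
    have "B \<inter> A = {}" "7 \<le> card B + card A" using *(3,6) assms(2) by auto
    from spider_or_broad_grow[OF *(2,1) this(1) 1 this(2)] show ?thesis
      unfolding *(4,5) by (simp only: Un_commute[of A B] link_commute[of EA r EB u])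
  next
    case 2
    then show ?thesis
      unfolding *(4,5) using spider_or_broad_grow[OF *(1-3) 2] *(6) assms(2) by simp
  qed
qed

section \<open>Counting dissociation sets by the state of the root\<close>

definition dsets :: "'a set \<Rightarrow> 'a rel \<Rightarrow> 'a set set" where
  "dsets V E = {S. S \<subseteq> V \<and> (\<forall>v\<in>S. card {w \<in> S. (v, w) \<in> E} \<le> 1)}"

definition root_counts :: "'a set \<Rightarrow> 'a rel \<Rightarrow> 'a \<Rightarrow> nat \<times> nat \<times> nat" where
  "root_counts V E r =
    (card {S \<in> dsets V E. r \<in> S},
     card {S \<in> dsets V E. r \<notin> S},
     card {S \<in> dsets V E. r \<in> S \<and> (\<forall>w\<in>S. (r, w) \<notin> E)})"

text \<open>Linking \<open>r\<close> to \<open>s\<close> allows both in a set only if each is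
  isolated on its own side: \<open>g * x'\<close> counts the sets with \<open>r\<close> but not
  \<open>s\<close>, \<open>y * y'\<close> those with both. Without \<open>r\<close> the other side
  is arbitrary, and \<open>r\<close> stays isolated only if \<open>s\<close> is absent.\<close>

fun merge :: "nat \<times> nat \<times> nat \<Rightarrow> nat \<times> nat \<times> nat \<Rightarrow> nat \<times> nat \<times> nat" where
  "merge (g, x, y) (g', x', y') = (g * x' + y * y', x * (x' + g'), y * x')"

fun total :: "nat \<times> nat \<times> nat \<Rightarrow> nat" where
  "total (g, x, y) = g + x"

lemma finite_dsets: "finite V \<Longrightarrow> finite (dsets V E)"
  by (rule finite_subset[of _ "Pow V"]) (auto simp: dsets_def)

lemma total_root_counts:
  assumes "finite V"
  shows "total (root_counts V E r) = card (dsets V E)"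
proof -
  have "dsets V E = {S \<in> dsets V E. r \<in> S} \<union> {S \<in> dsets V E. r \<notin> S}" by blast
  then have "card (dsets V E) = card {S \<in> dsets V E. r \<in> S} + card {S \<in> dsets V E. r \<notin> S}"
    by (metis (no_types, lifting) card_Un_disjoint finite_Un finite_dsets[OF assms] disjoint_iff mem_Collect_eq)
  then show ?thesis by (simp add: root_counts_def)
qed

lemma card_Collect_subset_Un:
  assumes "V \<inter> W = {}"
  shows "card {S. S \<subseteq> V \<union> W \<and> P S} = card {(A, B). A \<subseteq> V \<and> B \<subseteq> W \<and> P (A \<union> B)}"
proof -
  have "bij_betw (\<lambda>S. (S \<inter> V, S \<inter> W)) {S. S \<subseteq> V \<union> W \<and> P S} {(A, B). A \<subseteq> V \<and> B \<subseteq> W \<and> P (A \<union> B)}"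
  proof (rule bij_betwI[where g = "\<lambda>(A, B). A \<union> B"])
    show "(\<lambda>S. (S \<inter> V, S \<inter> W)) \<in> {S. S \<subseteq> V \<union> W \<and> P S} \<rightarrow> {(A, B). A \<subseteq> V \<and> B \<subseteq> W \<and> P (A \<union> B)}"
      by (auto simp: Int_Un_distrib[symmetric] Int_absorb2)
  qed (use assms in auto)
  then show ?thesis by (rule bij_betw_same_card)
qed

text \<open>The new edge raises the degree of \<open>r\<close> by one exactly when \<open>s\<close>
  is chosen, and conversely; all other degrees are unchanged. With both ends chosen, the bound one
  forces their old degrees to be zero.\<close>

lemma dsets_link_iff:
  assumes "E \<subseteq> V \<times> V" "F \<subseteq> W \<times> W" "V \<inter> W = {}" "r \<in> V" "s \<in> W" "finite V" "finite W"
    and "A \<subseteq> V" "B \<subseteq> W"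
  shows "A \<union> B \<in> dsets (V \<union> W) (link E r F s) \<longleftrightarrow>
    A \<in> dsets V E \<and> B \<in> dsets W F \<and>
    (r \<in> A \<longrightarrow> s \<in> B \<longrightarrow> (\<forall>w\<in>A. (r, w) \<notin> E) \<and> (\<forall>w\<in>B. (s, w) \<notin> F))"
proof -
  \<comment> \<open>Stated for arbitrary data, so that it serves both sides with the roles
    exchanged.\<close>
  have nb: "card {w \<in> A' \<union> B'. (v, w) \<in> link E' r' F' s'} =
      card {w \<in> A'. (v, w) \<in> E'} + (if v = r' \<and> s' \<in> B' then 1 else 0)"
    if "E' \<subseteq> V' \<times> V'" "F' \<subseteq> W' \<times> W'" "V' \<inter> W' = {}" "r' \<in> V'" "s' \<in> W'" "finite V'"
      "A' \<subseteq> V'" "B' \<subseteq> W'" "v \<in> A'" for E' F' r' s' v and A' B' V' W' :: "'a set"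
  proof -
    have "{w \<in> A' \<union> B'. (v, w) \<in> link E' r' F' s'} =
      {w \<in> A'. (v, w) \<in> E'} \<union> (if v = r' \<and> s' \<in> B' then {s'} else {})"
      using that by (auto simp: link_def)
    moreover have "finite A'" using that(6,7) by (rule rev_finite_subset)
    moreover have "s' \<notin> A'" using that by blast
    ultimately show ?thesis by auto
  qed
  have A: "card {w \<in> A \<union> B. (v, w) \<in> link E r F s} =
      card {w \<in> A. (v, w) \<in> E} + (if v = r \<and> s \<in> B then 1 else 0)" if "v \<in> A" for v
    using nb[OF assms(1-6,8,9) that] .
  have B: "card {w \<in> A \<union> B. (v, w) \<in> link E r F s} =
      card {w \<in> B. (v, w) \<in> F} + (if v = s \<and> r \<in> A then 1 else 0)" if "v \<in> B" for v
    using nb[OF assms(2,1) _ assms(5,4,7,9,8) that] assms(3)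
    by (simp add: Un_commute link_commute[of E] Int_commute)
  have fin: "finite A" "finite B" using assms(6-9) by (auto intro: finite_subset)
  have "A \<union> B \<in> dsets (V \<union> W) (link E r F s) \<longleftrightarrow>
    (\<forall>v\<in>A. card {w \<in> A. (v, w) \<in> E} + (if v = r \<and> s \<in> B then 1 else 0) \<le> 1) \<and>
    (\<forall>v\<in>B. card {w \<in> B. (v, w) \<in> F} + (if v = s \<and> r \<in> A then 1 else 0) \<le> 1)"
  proof -
    have "A \<union> B \<in> dsets (V \<union> W) (link E r F s) \<longleftrightarrow>
      (\<forall>v\<in>A. card {w \<in> A \<union> B. (v, w) \<in> link E r F s} \<le> 1) \<and>
      (\<forall>v\<in>B. card {w \<in> A \<union> B. (v, w) \<in> link E r F s} \<le> 1)"
      using assms(8,9) unfolding dsets_def ball_Un by auto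
    then show ?thesis by (simp only: A B cong: ball_cong)
  qed
  also have "\<dots> \<longleftrightarrow> (\<forall>v\<in>A. card {w \<in> A. (v, w) \<in> E} \<le> 1) \<and> (\<forall>v\<in>B. card {w \<in> B. (v, w) \<in> F} \<le> 1)
     \<and> (r \<in> A \<longrightarrow> s \<in> B \<longrightarrow> card {w \<in> A. (r, w) \<in> E} = 0 \<and> card {w \<in> B. (s, w) \<in> F} = 0)"
    by (fastforce split: if_splits)
  finally show ?thesis using assms(8,9) fin by (auto simp: dsets_def)
qed

lemma root_counts_join:
  assumes "rtree V E r" "rtree W F s" "V \<inter> W = {}"
  shows "root_counts (V \<union> W) (link E r F s) r = merge (root_counts V E r) (root_counts W F s)"
proof -
  let ?D = "dsets (V \<union> W) (link E r F s)"
  define alone where "alone E r S \<longleftrightarrow> (\<forall>w\<in>S. (r, w) \<notin> E)" for E :: "'a rel" and r S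
  note fin = rtree_finite[OF assms(1)] rtree_finite[OF assms(2)]
  note fd = finite_dsets[OF fin(1), of E] finite_dsets[OF fin(2), of F]
  note root = rtree_root[OF assms(1)] rtree_root[OF assms(2)]
  note edges = rtree_edges[OF assms(1)] rtree_edges[OF assms(2)]
  note iff = dsets_link_iff[OF edges assms(3) root fin, folded alone_def]
  have sub: "A \<subseteq> V" if "A \<in> dsets V E" for A using that by (simp add: dsets_def)
  have sub': "B \<subseteq> W" if "B \<in> dsets W F" for B using that by (simp add: dsets_def)
  have not: "r \<notin> B" if "B \<in> dsets W F" for B
    using sub'[OF that] root(1) assms(3) by auto
  have count: "card {S \<in> ?D. P S} = card {(A, B). A \<in> dsets V E \<and> B \<in> dsets W F
      \<and> (r \<in> A \<longrightarrow> s \<in> B \<longrightarrow> alone E r A \<and> alone F s B) \<and> P (A \<union> B)}" for P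
  proof -
    have "{S \<in> ?D. P S} = {S. S \<subseteq> V \<union> W \<and> (S \<in> ?D \<and> P S)}" by (auto simp: dsets_def)
    then have "card {S \<in> ?D. P S} = card {(A, B). A \<subseteq> V \<and> B \<subseteq> W \<and> (A \<union> B \<in> ?D \<and> P (A \<union> B))}"
      using card_Collect_subset_Un[OF assms(3)] by simp
    moreover have "A \<subseteq> V \<and> B \<subseteq> W \<and> (A \<union> B \<in> ?D \<and> P (A \<union> B)) \<longleftrightarrow>
      A \<in> dsets V E \<and> B \<in> dsets W F
      \<and> (r \<in> A \<longrightarrow> s \<in> B \<longrightarrow> alone E r A \<and> alone F s B) \<and> P (A \<union> B)" for A B
      using iff[of A B] sub[of A] sub'[of B] by argo
    ultimately show ?thesis by presburger
  qed
  have alone_link: "alone (link E r F s) r (A \<union> B) \<longleftrightarrow> alone E r A \<and> s \<notin> B"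
    if "A \<in> dsets V E" "B \<in> dsets W F" for A B
    using sub[OF that(1)] sub'[OF that(2)] root edges assms(3) by (auto simp: alone_def link_def)
  have totalW: "card (dsets W F) = card {S \<in> dsets W F. s \<notin> S} + card {S \<in> dsets W F. s \<in> S}"
    using total_root_counts[OF fin(2), of F s] by (simp add: root_counts_def)
  have "card {S \<in> ?D. r \<notin> S} = card ({S \<in> dsets V E. r \<notin> S} \<times> dsets W F)"
    unfolding count by (rule arg_cong[where f = card]) (use not in auto)
  moreover have "card {S \<in> ?D. r \<in> S \<and> alone (link E r F s) r S} =
      card ({S \<in> dsets V E. r \<in> S \<and> alone E r S} \<times> {S \<in> dsets W F. s \<notin> S})"
    unfolding count by (rule arg_cong[where f = card]) (use not alone_link in auto)
  moreover have "card {S \<in> ?D. r \<in> S} =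
      card ({S \<in> dsets V E. r \<in> S} \<times> {S \<in> dsets W F. s \<notin> S} \<union>
        {S \<in> dsets V E. r \<in> S \<and> alone E r S} \<times> {S \<in> dsets W F. s \<in> S \<and> alone F s S})"
    unfolding count by (rule arg_cong[where f = card]) (use not in auto)
  moreover have "\<dots> = card ({S \<in> dsets V E. r \<in> S} \<times> {S \<in> dsets W F. s \<notin> S}) +
        card ({S \<in> dsets V E. r \<in> S \<and> alone E r S} \<times> {S \<in> dsets W F. s \<in> S \<and> alone F s S})"
    using fd by (intro card_Un_disjoint) auto
  ultimately show ?thesis
    unfolding root_counts_def alone_def[symmetric] by (simp add: card_cartesian_product totalW)
qed

lemma root_counts_single: "root_counts {r} {} r = (1, 1, 1)"
proof -
  have "dsets {r} {} = {{}, {r}}" by (auto simp: dsets_def)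
  then have "{S \<in> dsets {r} {}. r \<in> S} = {{r}}" "{S \<in> dsets {r} {}. r \<notin> S} = {{}}"
    "{S \<in> dsets {r} {}. r \<in> S \<and> (\<forall>w\<in>S. (r, w) \<notin> {})} = {{r}}" by auto
  then show ?thesis by (simp add: root_counts_def)
qed

lemma root_counts_pair: "b \<noteq> c \<Longrightarrow> root_counts {b, c} {(b, c), (c, b)} b = (2, 2, 1)"
  using root_counts_join[OF rtree.single rtree.single, of b c]
  by (simp add: root_counts_single link_def insert_commute)

lemma card_spider: "spider V E r s t \<Longrightarrow> card V = Suc (s + 2 * t)"
proof (induction rule: spider.induct)
  case (short_leg V E r s t b)
  then show ?case using rtree_finite[OF spider_rtree] by fastforce
next
  case (long_leg V E r s t b c)
  then show ?case using rtree_finite[OF spider_rtree[OF long_leg(1)]] by simp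
qed simp

text \<open>A short leg takes \<open>(g, x, y)\<close> to \<open>(g + y, 2 * x, y)\<close>, a long
  one to \<open>(2 * g + y, 4 * x, 2 * y)\<close>. The factor 2 before \<open>g\<close> avoids the
  half in the closed form.\<close>

lemma root_counts_spider:
  assumes "spider V E r s t"
  shows "\<exists>g. root_counts V E r = (g, 2 ^ (s + 2 * t), 2 ^ t) \<and> 2 * g = (2 * s + t + 2) * 2 ^ t"
  using assms
proof (induction rule: spider.induct)
  case (center r)
  then show ?case by (simp add: root_counts_single)
next
  case (short_leg V E r s t b)
  then show ?case
    using root_counts_join[OF spider_rtree[OF short_leg(1)] rtree.single, of b]
    by (auto simp: root_counts_single algebra_simps)
next
  case (long_leg V E r s t b c)
  then show ?case
    using root_counts_join[OF spider_rtree[OF long_leg(1)] rtree_pair, of b c]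
    by (auto simp: root_counts_pair algebra_simps)
qed

lemma card_dsets_spider:
  assumes "spider V E r s t"
  shows "2 * card (dsets V E) = 2 ^ Suc (s + 2 * t) + (2 * s + t + 2) * 2 ^ t"
  using root_counts_spider[OF assms] total_root_counts[of V E r]
    rtree_finite[OF spider_rtree[OF assms]]
  by auto

section \<open>Trees that are not spiders\<close>

text \<open>Forgets the tree and keeps its order and triple, so that extremal questions about trees
  of small order become finite computations.\<close>

inductive profile :: "nat \<Rightarrow> nat \<times> nat \<times> nat \<Rightarrow> bool" where
  single: "profile 1 (1, 1, 1)"
| merge: "profile i p \<Longrightarrow> profile j q \<Longrightarrow> profile (i + j) (merge p q)"

lemma rtree_profile: "rtree V E r \<Longrightarrow> profile (card V) (root_counts V E r)"
proof (induction rule: rtree.induct)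
  case (single r)
  then show ?case using profile.single by (simp add: root_counts_single)
next
  case (join V E r W F s)
  then have "card (V \<union> W) = card V + card W"
    by (intro card_Un_disjoint) (auto dest: rtree_finite)
  then show ?case using join profile.merge by (simp add: root_counts_join)
qed

fun dominated :: "nat \<times> nat \<times> nat \<Rightarrow> nat \<times> nat \<times> nat \<Rightarrow> bool" where
  "dominated (g, x, y) (g', x', y') \<longleftrightarrow> g \<le> g' \<and> x \<le> x' \<and> y \<le> y'"

lemma dominated_refl: "dominated p p"
  by (cases p) simp

lemma dominated_trans: "dominated p q \<Longrightarrow> dominated q r \<Longrightarrow> dominated p r"
  by (cases p; cases q; cases r) auto

lemma dominated_merge: "dominated p p' \<Longrightarrow> dominated q q' \<Longrightarrow> dominated (merge p q) (merge p' q')"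
  by (cases p; cases q; cases p'; cases q') (auto intro!: add_mono mult_mono)

lemma total_mono: "dominated p q \<Longrightarrow> total p \<le> total q"
  by (cases p; cases q) auto

text \<open>Entry \<open>k\<close> lists the maximal elements of the set of profiles of order \<open>k\<close> under domination; it is
  used for \<open>1 \<le> k \<le> 8\<close> only.\<close>

definition maximal_profiles :: "nat \<Rightarrow> (nat \<times> nat \<times> nat) list" where
  "maximal_profiles k = [[],
    [(1, 1, 1)],
    [(2, 2, 1)],
    [(3, 4, 2)],
    [(5, 8, 2), (6, 7, 4)],
    [(8, 16, 4), (10, 13, 8), (10, 14, 4), (11, 13, 7)],
    [(12, 32, 4), (16, 28, 8), (18, 26, 8), (20, 24, 16), (21, 23, 13)],
    [(20, 64, 8), (24, 56, 8), (28, 52, 16), (29, 52, 14), (32, 49, 16), (36, 44, 32),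
     (36, 48, 16), (40, 44, 24)],
    [(28, 128, 8), (40, 112, 16), (44, 104, 16), (48, 98, 16), (56, 96, 32), (58, 91, 28),
     (68, 88, 32), (72, 84, 64), (76, 80, 44)]] ! k"

text \<open>The table is closed under merging up to domination, for all pairs of orders with sum at
  most 8; this is checked by evaluation.\<close>

lemma maximal_profiles_merge:
  "list_all (\<lambda>i. list_all (\<lambda>j. list_all (\<lambda>p. list_all (\<lambda>q.
      list_ex (dominated (merge p q)) (maximal_profiles (i + j)))
    (maximal_profiles j)) (maximal_profiles i)) [1..<9 - i]) [1..<8]"
  by code_simp

lemma profile_pos: "profile k p \<Longrightarrow> 0 < k"
  by (induction rule: profile.induct) auto

lemma profile_one: "profile 1 p \<Longrightarrow> p = (1, 1, 1)"
proof (erule profile.cases)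
  fix i p' j q assume "1 = i + j" "profile i p'" "profile j q"
  then show ?thesis using profile_pos[of i p'] profile_pos[of j q] by linarith
qed simp

lemma profile_dominated:
  "profile k p \<Longrightarrow> k \<le> 8 \<Longrightarrow> \<exists>q \<in> set (maximal_profiles k). dominated p q"
proof (induction rule: profile.induct)
  case single
  then show ?case by (simp add: maximal_profiles_def)
next
  case (merge i p j q)
  obtain p' q' where *: "p' \<in> set (maximal_profiles i)" "dominated p p'"
    "q' \<in> set (maximal_profiles j)" "dominated q q'"
    using merge by auto
  have "i \<in> set [1..<8]" "j \<in> set [1..<9 - i]"
    using merge.prems profile_pos[OF merge.hyps(1)] profile_pos[OF merge.hyps(2)] by auto
  then have "list_ex (dominated (merge p' q')) (maximal_profiles (i + j))"
    using maximal_profiles_merge * unfolding list_all_iff by blast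
  then show ?case
    using dominated_trans[OF dominated_merge[OF *(2,4)]] by (auto simp: list_ex_iff)
qed

section \<open>Broad trees of order 9, 10 and 11\<close>

inductive broad_profile :: "nat \<Rightarrow> nat \<times> nat \<times> nat \<Rightarrow> bool" where
  three: "profile i p \<Longrightarrow> profile j q \<Longrightarrow> profile k u \<Longrightarrow> profile l v \<Longrightarrow> 3 \<le> j \<Longrightarrow>
    broad_profile (i + j + k + l) (merge (merge (merge p q) u) v)"
| two: "profile i p \<Longrightarrow> profile j q \<Longrightarrow> profile k u \<Longrightarrow> 3 \<le> j \<Longrightarrow> 3 \<le> k \<Longrightarrow>
    broad_profile (i + j + k) (merge (merge p q) u)"

lemma broad_broad_profile:
  assumes "broad V E r"
  shows "broad_profile (card V) (root_counts V E r)"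
  using assms
proof cases
  case (three_branches R F A EA a B EB b C EC c)
  note j1 = rtree.join[OF three_branches(3,4,7)]
  note j2 = rtree.join[OF j1 three_branches(5,8)]
  have "card V = card R + card A + card B + card C"
    using three_branches(3-9) unfolding three_branches(1)
    by (simp add: card_Un_disjoint rtree_finite)
  moreover have "root_counts V E r =
    merge (merge (merge (root_counts R F r) (root_counts A EA a)) (root_counts B EB b)) (root_counts C EC c)"
    unfolding three_branches(1,2)
      root_counts_join[OF j2 three_branches(6,9)] root_counts_join[OF j1 three_branches(5,8)]
      root_counts_join[OF three_branches(3,4,7)] ..
  ultimately show ?thesis
    using broad_profile.three[OF three_branches(3-6)[THEN rtree_profile] three_branches(10)] by simp
next
  case (two_branches R F A EA a B EB b)
  note j1 = rtree.join[OF two_branches(3,4,6)]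
  have "card V = card R + card A + card B"
    using two_branches(3-7) unfolding two_branches(1)
    by (simp add: card_Un_disjoint rtree_finite)
  moreover have "root_counts V E r =
    merge (merge (root_counts R F r) (root_counts A EA a)) (root_counts B EB b)"
    unfolding two_branches(1,2) root_counts_join[OF j1 two_branches(5,7)]
      root_counts_join[OF two_branches(3,4,6)] ..
  ultimately show ?thesis
    using broad_profile.two[OF two_branches(3-5)[THEN rtree_profile] two_branches(8,9)] by simp
qed

text \<open>These are the exact maxima of the number of dissociation sets over broad trees of order 9, 10
  and 11. The orders 9 and 10 need their own values, since doubling the value for order 9 exceeds
  \<open>h 10\<close>; from order 11 on the bound \<open>2 ^ (n - 1)\<close> is preserved by doubling.\<close>

definition small_bound :: "nat \<Rightarrow> nat" where
  "small_bound n = (if n = 9 then 280 else if n = 10 then 544 else 1024)"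

text \<open>The order of the last branch is what the others leave. With \<open>j \<ge> 3\<close> and
  the other orders positive, an order of at most 11 leaves at most 8 vertices for each part, which
  the table covers.\<close>

lemma three_branches_maximal:
  "list_all (\<lambda>n. list_all (\<lambda>i. list_all (\<lambda>j. list_all (\<lambda>k.
    list_all (\<lambda>p. list_all (\<lambda>q. list_all (\<lambda>u. list_all (\<lambda>v.
      total (merge (merge (merge p q) u) v) \<le> small_bound n)
    (maximal_profiles (n - (i + j + k)))) (maximal_profiles k)) (maximal_profiles j)) (maximal_profiles i))
    [1..<n - (i + j)]) [3..<n - i - 1]) [1..<n - 4]) [9, 10, 11]"
  by code_simp

lemma two_branches_maximal:
  "list_all (\<lambda>n. list_all (\<lambda>i. list_all (\<lambda>j.
    list_all (\<lambda>p. list_all (\<lambda>q. list_all (\<lambda>u.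
      total (merge (merge p q) u) \<le> small_bound n)
    (maximal_profiles (n - (i + j)))) (maximal_profiles j)) (maximal_profiles i))
    [3..<n - i - 2]) [1..<n - 5]) [9, 10, 11]"
  by code_simp

lemma broad_profile_total_small:
  assumes "broad_profile n p" "n \<in> {9, 10, 11}"
  shows "total p \<le> small_bound n"
  using assms(1)
proof cases
  case (three i p1 j p2 k p3 l p4)
  have pos: "0 < i" "0 < k" "0 < l" using three profile_pos by auto
  then have le: "i \<le> 8" "j \<le> 8" "k \<le> 8" "l \<le> 8" using three assms(2) by auto
  obtain q1 q2 q3 q4 where q: "q1 \<in> set (maximal_profiles i)" "dominated p1 q1"
    "q2 \<in> set (maximal_profiles j)" "dominated p2 q2"
    "q3 \<in> set (maximal_profiles k)" "dominated p3 q3"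
    "q4 \<in> set (maximal_profiles l)" "dominated p4 q4"
    using profile_dominated[OF three(3) le(1)] profile_dominated[OF three(4) le(2)]
      profile_dominated[OF three(5) le(3)] profile_dominated[OF three(6) le(4)] by blast
  have "n \<in> set [9, 10, 11]" "i \<in> set [1..<n - 4]" "j \<in> set [3..<n - i - 1]"
    "k \<in> set [1..<n - (i + j)]" and l: "l = n - (i + j + k)"
    using assms(2) three(1,7) pos by auto
  then have "total (merge (merge (merge q1 q2) q3) q4) \<le> small_bound n"
    using three_branches_maximal q(1,3,5,7) unfolding list_all_iff l by blast
  moreover have "dominated p (merge (merge (merge q1 q2) q3) q4)"
    unfolding three(2) using q by (intro dominated_merge)
  ultimately show ?thesis using total_mono order_trans by blast
next
  case (two i p1 j p2 k p3)
  have pos: "0 < i" using two profile_pos by auto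
  then have le: "i \<le> 8" "j \<le> 8" "k \<le> 8" using two assms(2) by auto
  obtain q1 q2 q3 where q: "q1 \<in> set (maximal_profiles i)" "dominated p1 q1"
    "q2 \<in> set (maximal_profiles j)" "dominated p2 q2"
    "q3 \<in> set (maximal_profiles k)" "dominated p3 q3"
    using profile_dominated[OF two(3) le(1)] profile_dominated[OF two(4) le(2)]
      profile_dominated[OF two(5) le(3)] by blast
  have "n \<in> set [9, 10, 11]" "i \<in> set [1..<n - 5]" "j \<in> set [3..<n - i - 2]"
    and k: "k = n - (i + j)"
    using assms(2) two(1,6,7) pos by auto
  then have "total (merge (merge q1 q2) q3) \<le> small_bound n"
    using two_branches_maximal q(1,3,5) unfolding list_all_iff k by blast
  moreover have "dominated p (merge (merge q1 q2) q3)"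
    unfolding two(2) using q by (intro dominated_merge)
  ultimately show ?thesis using total_mono order_trans by blast
qed

section \<open>Deleting a leaf, and broad trees of larger order\<close>

fun double :: "nat \<times> nat \<times> nat \<Rightarrow> nat \<times> nat \<times> nat" where
  "double (g, x, y) = (2 * g, 2 * x, 2 * y)"

lemma merge_double: "merge (double p) q = double (merge p q)" "merge p (double q) = double (merge p q)"
  by (cases p; cases q; simp add: algebra_simps)+

lemma dominated_double_merge_left:
  "dominated p (double p') \<Longrightarrow> dominated (merge p q) (double (merge p' q))"
  using dominated_merge[OF _ dominated_refl] by (simp flip: merge_double(1))

lemma dominated_double_merge_right:
  "dominated q (double q') \<Longrightarrow> dominated (merge p q) (double (merge p q'))"
  using dominated_merge[OF dominated_refl] by (simp flip: merge_double(2))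

text \<open>Being isolated is a special case of being chosen; on triples this follows from the form
  of \<open>merge\<close>. It ensures that a new leaf at most doubles the first entry.\<close>

lemma profile_alone_le: "profile k (g, x, y) \<Longrightarrow> y \<le> g"
proof (induction k "(g, x, y)" arbitrary: g x y rule: profile.induct)
  case (merge i p j q)
  obtain a b c where p: "p = (a, b, c)" by (cases p)
  obtain a' b' c' where q: "q = (a', b', c')" by (cases q)
  have "c * b' \<le> a * b'" using merge.hyps(2)[OF p] by simp
  moreover have "g = a * b' + c * c'" "y = c * b'" using merge.hyps(5) by (auto simp: p q)
  ultimately show ?case by linarith
qed simp

text \<open>The branch joined last is followed until it is a single vertex, a leaf other than the
  root. Adding that leaf gives \<open>(g + y, 2 * x, y)\<close>, within twice
  \<open>(g, x, y)\<close> as \<open>y \<le> g\<close>, and bilinearity carries the factor through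
  the enclosing merges.\<close>

lemma profile_shrink:
  "profile k p \<Longrightarrow> 2 \<le> k \<Longrightarrow> \<exists>q. profile (k - 1) q \<and> dominated p (double q)"
proof (induction rule: profile.induct)
  case (merge i p j q)
  show ?case
  proof (cases "j = 1")
    case True
    then have q: "q = (1, 1, 1)" using profile_one merge.hyps(2) by blast
    obtain g x y where p: "p = (g, x, y)" by (cases p)
    have "dominated (merge p q) (double p)"
      using profile_alone_le merge.hyps(1) by (simp add: p q)
    then show ?thesis using merge.hyps(1) True by (intro exI[of _ p]) simp
  next
    case False
    then have "2 \<le> j" using profile_pos[OF merge.hyps(2)] by simp
    then obtain q' where q': "profile (j - 1) q'" "dominated q (double q')" using merge.IH by blast
    have "profile (i + (j - 1)) (merge p q')" using merge.hyps(1) q'(1) by (rule profile.merge)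
    moreover have "dominated (merge p q) (double (merge p q'))"
      using q'(2) by (rule dominated_double_merge_right)
    ultimately show ?thesis using \<open>2 \<le> j\<close> by (intro exI[of _ "merge p q'"]) simp
  qed
qed simp

text \<open>A leaf is deleted inside a single part, so the shape survives as long as that part stays
  nonempty, or of order at least three where this is demanded.\<close>

lemma broad_profile_shrink:
  assumes "broad_profile n p" "9 \<le> n"
  shows "\<exists>q. broad_profile (n - 1) q \<and> dominated p (double q)"
  using assms(1)
proof cases
  case (three i p1 j p2 k p3 l p4)
  \<comment> \<open>The smallest orders of the four parts are 1, 3, 1 and 1, with sum 6, so some
    part has room to shrink.\<close>
  consider "2 \<le> i" | "4 \<le> j" | "2 \<le> k" | "2 \<le> l" using three(1) assms(2) by linarith
  then show ?thesis
  proof cases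
    case 1
    then obtain q where q: "profile (i - 1) q" "dominated p1 (double q)"
      using profile_shrink three(3) by blast
    have "broad_profile (i - 1 + j + k + l) (merge (merge (merge q p2) p3) p4)"
      by (rule broad_profile.three) (use three q in auto)
    moreover have "dominated p (double (merge (merge (merge q p2) p3) p4))"
      unfolding three(2)
      by (rule dominated_double_merge_left, rule dominated_double_merge_left, rule dominated_double_merge_left, rule q(2))
    ultimately show ?thesis using 1 three(1) by (intro exI conjI) auto
  next
    case 2
    then obtain q where q: "profile (j - 1) q" "dominated p2 (double q)"
      using profile_shrink[OF three(4)] by auto
    have "broad_profile (i + (j - 1) + k + l) (merge (merge (merge p1 q) p3) p4)"
      by (rule broad_profile.three) (use three q 2 in auto)
    moreover have "dominated p (double (merge (merge (merge p1 q) p3) p4))"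
      unfolding three(2)
      by (rule dominated_double_merge_left, rule dominated_double_merge_left, rule dominated_double_merge_right, rule q(2))
    ultimately show ?thesis using 2 three(1) by (intro exI conjI) auto
  next
    case 3
    then obtain q where q: "profile (k - 1) q" "dominated p3 (double q)"
      using profile_shrink three(5) by blast
    have "broad_profile (i + j + (k - 1) + l) (merge (merge (merge p1 p2) q) p4)"
      by (rule broad_profile.three) (use three q in auto)
    moreover have "dominated p (double (merge (merge (merge p1 p2) q) p4))"
      unfolding three(2)
      by (rule dominated_double_merge_left, rule dominated_double_merge_right, rule q(2))
    ultimately show ?thesis using 3 three(1) by (intro exI conjI) auto
  next
    case 4
    then obtain q where q: "profile (l - 1) q" "dominated p4 (double q)"
      using profile_shrink three(6) by blast
    have "broad_profile (i + j + k + (l - 1)) (merge (merge (merge p1 p2) p3) q)"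
      by (rule broad_profile.three) (use three q in auto)
    moreover have "dominated p (double (merge (merge (merge p1 p2) p3) q))"
      unfolding three(2)
      by (rule dominated_double_merge_right, rule q(2))
    ultimately show ?thesis using 4 three(1) by (intro exI conjI) auto
  qed
next
  case (two i p1 j p2 k p3)
  \<comment> \<open>Here the smallest orders are 1, 3 and 3, with sum 7.\<close>
  consider "2 \<le> i" | "4 \<le> j" | "4 \<le> k" using two(1) assms(2) by linarith
  then show ?thesis
  proof cases
    case 1
    then obtain q where q: "profile (i - 1) q" "dominated p1 (double q)"
      using profile_shrink two(3) by blast
    have "broad_profile (i - 1 + j + k) (merge (merge q p2) p3)"
      by (rule broad_profile.two) (use two q in auto)
    moreover have "dominated p (double (merge (merge q p2) p3))"
      unfolding two(2)
      by (rule dominated_double_merge_left, rule dominated_double_merge_left, rule q(2))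
    ultimately show ?thesis using 1 two(1) by (intro exI conjI) auto
  next
    case 2
    then obtain q where q: "profile (j - 1) q" "dominated p2 (double q)"
      using profile_shrink[OF two(4)] by auto
    have "broad_profile (i + (j - 1) + k) (merge (merge p1 q) p3)"
      by (rule broad_profile.two) (use two q 2 in auto)
    moreover have "dominated p (double (merge (merge p1 q) p3))"
      unfolding two(2)
      by (rule dominated_double_merge_left, rule dominated_double_merge_right, rule q(2))
    ultimately show ?thesis using 2 two(1) by (intro exI conjI) auto
  next
    case 3
    then obtain q where q: "profile (k - 1) q" "dominated p3 (double q)"
      using profile_shrink[OF two(5)] by auto
    have "broad_profile (i + j + (k - 1)) (merge (merge p1 p2) q)"
      by (rule broad_profile.two) (use two q 3 in auto)
    moreover have "dominated p (double (merge (merge p1 p2) q))"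
      unfolding two(2)
      by (rule dominated_double_merge_right, rule q(2))
    ultimately show ?thesis using 3 two(1) by (intro exI conjI) auto
  qed
qed

lemma broad_profile_total_large:
  "11 \<le> n \<Longrightarrow> broad_profile n p \<Longrightarrow> total p \<le> 2 ^ (n - 1)"
proof (induction n arbitrary: p rule: dec_induct)
  case base
  then show ?case using broad_profile_total_small[of 11 p] by (simp add: small_bound_def)
next
  case (step n)
  obtain q where q: "broad_profile n q" "dominated p (double q)"
    using broad_profile_shrink[OF step.prems] step.hyps by auto
  have "total p \<le> total (double q)" using q(2) by (rule total_mono)
  also have "\<dots> = 2 * total q" by (cases q) simp
  also have "\<dots> \<le> 2 * 2 ^ (n - 1)" using step.IH[OF q(1)] by simp
  also have "\<dots> = 2 ^ (Suc n - 1)" using step.hyps by (cases n) auto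
  finally show ?case .
qed

text \<open>\<open>h 9 = 292\<close> and \<open>h 10 = 556\<close> exceed the bounds 280 and 544;
  from order 11 on, the second summand of \<open>h n\<close> is a positive surplus over
  \<open>2 ^ (n - 1)\<close>.\<close>

lemma broad_total_less_h:
  assumes "broad_profile n p" "9 \<le> n"
  shows "total p < h n"
proof -
  consider "n = 9" | "n = 10" | "11 \<le> n" using assms(2) by linarith
  then show ?thesis
  proof cases
    case 3
    then show ?thesis
      using broad_profile_total_large[OF 3 assms(1)] by (auto simp: h_def intro: le_less_trans)
  qed (use broad_profile_total_small[OF assms(1)] in \<open>auto simp: small_bound_def h_def\<close>)
qed

section \<open>Undirected trees as rooted trees, and isomorphism of spiders\<close>

lemma num_dissociation_sets_eq:
  fixes G :: "'a pair_pre_digraph"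
  shows "num_dissociation_sets G = card (dsets (pverts G) (parcs G))"
proof -
  have "out_degree (with_proj G \<restriction> S) v = card {w \<in> S. (v, w) \<in> parcs G}" if "v \<in> S" for S v
  proof -
    have "out_arcs (with_proj G \<restriction> S) v = Pair v ` {w \<in> S. (v, w) \<in> parcs G}"
      using that by (auto simp: out_arcs_def)
    then show ?thesis by (simp add: out_degree_def card_image inj_on_def)
  qed
  then have "dissociation_set (with_proj G) S \<longleftrightarrow> S \<in> dsets (pverts G) (parcs G)" for S
    unfolding dissociation_set_def dsets_def by auto
  then show ?thesis by (simp add: num_dissociation_sets_def)
qed

section \<open>From connected cycle-free graphs to rooted trees\<close>

lemma pawalk_verts_append:
  "pcas u p r \<Longrightarrow> pawalk_verts u (p @ (r, s) # q) = pawalk_verts u p @ pawalk_verts s q"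
  by (induction p arbitrary: u) auto

lemma pcas_append: "pcas u p r \<Longrightarrow> pcas s q v \<Longrightarrow> pcas u (p @ (r, s) # q) v"
  by (induction p arbitrary: u) auto

text \<open>Paths within one part persist, and a path between the parts crosses the new edge once.
  Such paths close the forbidden cycles in \<open>undirected_tree_rtree\<close>.\<close>

lemma rtree_path:
  assumes "rtree V E r" "u \<in> V" "v \<in> V"
  shows "\<exists>p. pcas u p v \<and> set p \<subseteq> E \<and> distinct (pawalk_verts u p) \<and> set (pawalk_verts u p) \<subseteq> V"
  using assms
proof (induction arbitrary: u v rule: rtree.induct)
  case (single r)
  then show ?case by (intro exI[of _ "[]"]) simp
next
  case (join V E r W F s)
  have cross: "\<exists>p. pcas a p b \<and> set p \<subseteq> link E r F s \<and> distinct (pawalk_verts a p)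
      \<and> set (pawalk_verts a p) \<subseteq> V \<union> W"
    if p: "pcas a p c" "distinct (pawalk_verts a p)" "set (pawalk_verts a p) \<subseteq> A"
      and q: "pcas d q b" "distinct (pawalk_verts d q)" "set (pawalk_verts d q) \<subseteq> B"
      and "A \<inter> B = {}" "A \<union> B = V \<union> W" "insert (c, d) (set p \<union> set q) \<subseteq> link E r F s"
    for a b c d p q A B
  proof (intro exI[of _ "p @ (c, d) # q"] conjI)
    show "distinct (pawalk_verts a (p @ (c, d) # q))"
      unfolding pawalk_verts_append[OF p(1)] using that by auto
    show "set (pawalk_verts a (p @ (c, d) # q)) \<subseteq> V \<union> W"
      unfolding pawalk_verts_append[OF p(1)] using that by auto
  qed (use that pcas_append in auto)
  have r: "r \<in> V" "s \<in> W" using join.hyps(1,2) by (auto dest: rtree_root)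
  consider "u \<in> V" "v \<in> V" | "u \<in> W" "v \<in> W" | "u \<in> V" "v \<in> W" | "u \<in> W" "v \<in> V"
    using join.prems by blast
  then show ?case
  proof cases
    case 1
    then show ?thesis using join.IH(1)[OF 1] unfolding link_def by blast
  next
    case 2
    then show ?thesis using join.IH(2)[OF 2] unfolding link_def by blast
  next
    case 3
    obtain p where p: "pcas u p r" "distinct (pawalk_verts u p)" "set (pawalk_verts u p) \<subseteq> V" "set p \<subseteq> E"
      using join.IH(1)[OF 3(1) r(1)] by blast
    obtain q where q: "pcas s q v" "distinct (pawalk_verts s q)" "set (pawalk_verts s q) \<subseteq> W" "set q \<subseteq> F"
      using join.IH(2)[OF r(2) 3(2)] by blast
    show ?thesis by (rule cross[OF p(1-3) q(1-3) join.hyps(3)]) (use p(4) q(4) in \<open>auto simp: link_def\<close>)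
  next
    case 4
    obtain p where p: "pcas u p s" "distinct (pawalk_verts u p)" "set (pawalk_verts u p) \<subseteq> W" "set p \<subseteq> F"
      using join.IH(2)[OF 4(1) r(2)] by blast
    obtain q where q: "pcas r q v" "distinct (pawalk_verts r q)" "set (pawalk_verts r q) \<subseteq> V" "set q \<subseteq> E"
      using join.IH(1)[OF r(1) 4(2)] by blast
    have "W \<inter> V = {}" using join.hyps(3) by blast
    from cross[OF p(1-3) q(1-3) this] show ?thesis
      using p(4) q(4) by (auto simp: link_def)
  qed
qed

text \<open>Were there no edge leaving \<open>S\<close>, everything reachable from a vertex of
  \<open>S\<close> would lie in \<open>S\<close>, against connectivity.\<close>

lemma connected_cut:
  fixes T :: "'a pair_pre_digraph"
  assumes "pair_graph T" "connected T" "S \<subset> pverts T" "S \<noteq> {}"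
  shows "\<exists>a\<in>S. \<exists>b\<in>pverts T - S. (a, b) \<in> parcs T"
proof (rule ccontr)
  assume no: "\<not> ?thesis"
  interpret pair_graph T by fact
  have sym: "(v, u) \<in> parcs T" if "(u, v) \<in> parcs T" for u v
    using that pair_sym_arcs by (auto simp: symmetric_def dest: symD)
  obtain r where r: "r \<in> S" using assms(4) by blast
  have "v \<in> S" if "(r, v) \<in> rtrancl_on (pverts T) (symcl (parcs T))" for v
    using that
  proof (induction rule: rtrancl_on_induct)
    case (step y z)
    then show ?case using no sym by (auto simp: symcl_def)
  qed (rule r)
  then have "pverts T \<subseteq> S"
    using assms(2,3) r unfolding connected_conv by auto
  then show False using assms(3) by blast
qed

text \<open>Take a largest vertex set whose induced subgraph is a rooted tree. If it misses a
  vertex, connectivity gives an edge to some \<open>b\<close> outside; \<open>b\<close> has only one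
  neighbour inside, as two would close a cycle, so \<open>b\<close> can be attached as a
  leaf.\<close>

lemma undirected_tree_rtree:
  fixes T :: "'a pair_pre_digraph"
  assumes "pair_graph T" "undirected_tree T"
  shows "\<exists>r. rtree (pverts T) (parcs T) r"
proof -
  interpret pair_graph T by fact
  have sym: "(v, u) \<in> parcs T" if "(u, v) \<in> parcs T" for u v
    using that pair_sym_arcs by (auto simp: symmetric_def dest: symD)
  have conn: "connected T" and acyc: "\<And>p. cycle p \<Longrightarrow> length p < 3"
    using assms(2) unfolding undirected_tree_def by (auto simp: not_le)
  define good where "good S \<longleftrightarrow> S \<subseteq> pverts T \<and> (\<exists>r. rtree S (parcs T \<inter> S \<times> S) r)" for S
  obtain r0 where r0: "r0 \<in> pverts T" using conn unfolding connected_conv by auto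
  have "parcs T \<inter> {r0} \<times> {r0} = {}" using pair_no_loops by fastforce
  then have "good {r0}" using r0 rtree.single[of r0] unfolding good_def by auto
  moreover have "\<forall>S. good S \<longrightarrow> card S \<le> card (pverts T)"
    unfolding good_def using pair_finite_verts card_mono by blast
  ultimately obtain S where S: "good S" "\<And>S'. good S' \<Longrightarrow> card S' \<le> card S"
    using ex_has_greatest_nat[of good "{r0}" card] by (metis less_Suc_eq_le)
  then obtain r where r: "S \<subseteq> pverts T" "rtree S (parcs T \<inter> S \<times> S) r"
    unfolding good_def by blast
  have "S = pverts T"
  proof (rule ccontr)
    assume "S \<noteq> pverts T"
    then obtain a b where ab: "a \<in> S" "b \<in> pverts T" "b \<notin> S" "(a, b) \<in> parcs T"
      using connected_cut[OF assms(1) conn, of S] r rtree_root by fastforce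
    have unique: "a' = a" if a': "a' \<in> S" "(a', b) \<in> parcs T" for a'
    proof (rule ccontr)
      assume "a' \<noteq> a"
      obtain p where p: "pcas a p a'" "set p \<subseteq> parcs T \<inter> S \<times> S" "distinct (pawalk_verts a p)"
        "set (pawalk_verts a p) \<subseteq> S"
        using rtree_path[OF r(2) ab(1) a'(1)] by blast
      let ?c = "(b, a) # p @ [(a', b)]"
      \<comment> \<open>As \<open>a'\<close> differs from \<open>a\<close>, the path
        \<open>p\<close> has at least one arc and \<open>?c\<close> at least three, the length that
        \<open>undirected_tree\<close> excludes.\<close>
      have "p \<noteq> []" using p(1) \<open>a' \<noteq> a\<close> by auto
      moreover have "awalk b ?c b"
        using p(1,2) ab a' sym pcas_append[of a p a' b "[]" b] by (auto simp: awalk_def)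
      moreover have "distinct (tl (pawalk_verts b ?c))"
        using p(3,4) ab(3) by (auto simp: pawalk_verts_append[OF p(1)])
      ultimately show False using acyc[of ?c] by (cases p) (auto simp: cycle_def)
    qed
    have unique': "a' = a" if "a' \<in> S" "(b, a') \<in> parcs T" for a'
      using unique[OF that(1) sym[OF that(2)]] .
    have b: "(b, b) \<notin> parcs T" "(b, a) \<in> parcs T"
      using pair_no_loops[of "(b, b)"] sym[OF ab(4)] by auto
    have "parcs T \<inter> (S \<union> {b}) \<times> (S \<union> {b}) = link (parcs T \<inter> S \<times> S) a {} b"
    proof (intro equalityI subrelI)
      fix u v assume uv: "(u, v) \<in> parcs T \<inter> (S \<union> {b}) \<times> (S \<union> {b})"
      then consider "u \<in> S" "v \<in> S" | "u \<in> S" "v = b" | "u = b" "v \<in> S" using b(1) by auto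
      then show "(u, v) \<in> link (parcs T \<inter> S \<times> S) a {} b"
      proof cases
        case 2
        then show ?thesis using unique[of u] uv by (simp add: link_def)
      next
        case 3
        then show ?thesis using unique'[of v] uv by (simp add: link_def)
      qed (use uv in \<open>simp add: link_def\<close>)
    next
      fix u v assume "(u, v) \<in> link (parcs T \<inter> S \<times> S) a {} b"
      then show "(u, v) \<in> parcs T \<inter> (S \<union> {b}) \<times> (S \<union> {b})"
        using ab(1,4) b(2) by (auto simp: link_def)
    qed
    moreover have "rtree (S \<union> {b}) (link (parcs T \<inter> S \<times> S) a {} b) r"
      by (rule rtree_attach[OF r(2) ab(1) rtree.single]) (use ab(3) in auto)
    ultimately have "good (S \<union> {b})" unfolding good_def using r(1) ab(2) by auto
    then show False using S(2)[of "S \<union> {b}"] ab(3) rtree_finite[OF r(2)] by simp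
  qed
  moreover have "parcs T \<inter> pverts T \<times> pverts T = parcs T" using in_arcsD1 in_arcsD2 by auto
  ultimately show ?thesis using r(2) by auto
qed

text \<open>An arc is the pair of its ends, so the arc map of an isomorphism is determined by its
  vertex map \<open>f\<close> as \<open>map_prod f f\<close>.\<close>

lemma digraph_iso_iff:
  fixes G :: "'a pair_pre_digraph" and H :: "'b pair_pre_digraph"
  assumes "pair_wf_digraph G"
  shows "digraph_iso G H \<longleftrightarrow> (\<exists>f. inj_on f (pverts G) \<and> pverts H = f ` pverts G
    \<and> parcs H = map_prod f f ` parcs G)"
proof
  interpret pair_wf_digraph G by fact
  assume "digraph_iso G H"
  then obtain m where m: "digraph_isomorphism m" "with_proj H = app_iso m (with_proj G)"
    unfolding digraph_iso_def by blast
  have "iso_tail m = fst" "iso_head m = snd" "pverts H = iso_verts m ` pverts G"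
    "parcs H = iso_arcs m ` parcs G"
    using m(2) by (auto simp: with_proj_def app_iso_def)
  moreover have "iso_arcs m e = map_prod (iso_verts m) (iso_verts m) e" if "e \<in> parcs G" for e
    using iso_verts_tail[OF m(1)] iso_verts_head[OF m(1)] that calculation(1,2)
    by (auto simp: prod_eq_iff)
  moreover have "inj_on (iso_verts m) (pverts G)"
    using digraph_isomorphism_inj_on_verts[OF m(1)] by simp
  ultimately show "\<exists>f. inj_on f (pverts G) \<and> pverts H = f ` pverts G
    \<and> parcs H = map_prod f f ` parcs G"
    by (intro exI[of _ "iso_verts m"]) (auto intro!: image_cong)
next
  interpret pair_wf_digraph G by fact
  assume "\<exists>f. inj_on f (pverts G) \<and> pverts H = f ` pverts G
    \<and> parcs H = map_prod f f ` parcs G"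
  then obtain f where f: "inj_on f (pverts G)" "pverts H = f ` pverts G"
    "parcs H = map_prod f f ` parcs G" by blast
  let ?m = "\<lparr>iso_verts = f, iso_arcs = map_prod f f, iso_head = snd, iso_tail = fst\<rparr>"
  have "parcs G \<subseteq> pverts G \<times> pverts G" using in_arcsD1 in_arcsD2 by auto
  then have "inj_on (map_prod f f) (parcs G)"
    using map_prod_inj_on[OF f(1) f(1)] inj_on_subset by blast
  then have "digraph_isomorphism ?m"
    using f(1) wf_digraph_axioms by (simp add: digraph_isomorphism_def)
  moreover have "with_proj H = app_iso ?m (with_proj G)"
    using f by (simp add: with_proj_def app_iso_def)
  ultimately show "digraph_iso G H" unfolding digraph_iso_def by blast
qed

section \<open>Isomorphism types of spiders\<close>

lemma link_image: "map_prod f f ` link E r F s = link (map_prod f f ` E) (f r) (map_prod f f ` F) (f s)"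
  by (auto simp: link_def image_Un)

lemma spider_image:
  assumes "spider V E r s t" "inj_on f V"
  shows "spider (f ` V) (map_prod f f ` E) (f r) s t"
  using assms
proof (induction rule: spider.induct)
  case (center r)
  then show ?case by (simp add: spider.center)
next
  case (short_leg V E r s t b)
  then have "spider (f ` V \<union> {f b}) (link (map_prod f f ` E) (f r) {} (f b)) (f r) (Suc s) t"
    by (intro spider.short_leg) (auto simp: inj_on_Un)
  then show ?case by (simp add: link_image)
next
  case (long_leg V E r s t b c)
  then have "spider (f ` V \<union> {f b, f c}) (link (map_prod f f ` E) (f r) {(f b, f c), (f c, f b)} (f b)) (f r) s (Suc t)"
    by (intro spider.long_leg) (auto simp: inj_on_Un)
  then show ?case by (simp add: link_image image_Un)
qed

text \<open>A reference copy of the spider: the first coordinate gives the kind of vertex, 0 for the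
  centre, 1 for the end of a short leg, 2 and 3 for the inner and outer vertex of a long leg; the
  second numbers the legs.\<close>

definition std_verts :: "nat \<Rightarrow> nat \<Rightarrow> (nat \<times> nat) set" where
  "std_verts s t = {(0, 0)} \<union> Pair 1 ` {..<s} \<union> Pair 2 ` {..<t} \<union> Pair 3 ` {..<t}"

definition std_edges :: "nat \<Rightarrow> nat \<Rightarrow> (nat \<times> nat) rel" where
  "std_edges s t = (\<Union>i<s. {((0, 0), (1, i)), ((1, i), (0, 0))}) \<union>
    (\<Union>i<t. {((0, 0), (2, i)), ((2, i), (0, 0)), ((2, i), (3, i)), ((3, i), (2, i))})"

lemma inj_on_Un_disjoint_images:
  "inj_on g A \<Longrightarrow> inj_on g B \<Longrightarrow> g ` A \<inter> g ` B = {} \<Longrightarrow> inj_on g (A \<union> B)"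
  by (auto simp: inj_on_Un)

text \<open>Each new leg is sent to the next free index of its kind, \<open>s\<close> or
  \<open>t\<close>, and the map on the old vertices is kept.\<close>

lemma spider_standard_form:
  assumes "spider V E r s t"
  shows "\<exists>f. inj_on f V \<and> f ` V = std_verts s t \<and> map_prod f f ` E = std_edges s t \<and> f r = (0, 0)"
  using assms
proof (induction rule: spider.induct)
  case (center r)
  then show ?case by (intro exI[of _ "\<lambda>_. (0, 0)"]) (simp add: std_verts_def std_edges_def)
next
  case (short_leg V E r s t b)
  then obtain f where f: "inj_on f V" "f ` V = std_verts s t" "map_prod f f ` E = std_edges s t"
    "f r = (0, 0)" by blast
  note rt = spider_rtree[OF short_leg.hyps(1)]
  let ?g = "f(b := (1, s))"
  have eq: "?g v = f v" if "v \<in> V" for v using that short_leg.hyps(2) by auto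
  have gV: "?g ` V = std_verts s t" using eq f(2) by (simp cong: image_cong)
  have gE: "map_prod ?g ?g ` E = std_edges s t"
    unfolding f(3)[symmetric] using eq rtree_edges[OF rt] by (intro image_cong) auto
  have gr: "?g r = (0, 0)" using eq rtree_root[OF rt] f(4) by simp
  have "inj_on ?g V" using f(1) eq by (simp cong: inj_on_cong)
  moreover have "?g ` V \<inter> ?g ` {b} = {}" unfolding gV by (auto simp: std_verts_def)
  ultimately have "inj_on ?g (V \<union> {b})" by (intro inj_on_Un_disjoint_images) simp_all
  moreover have "?g ` (V \<union> {b}) = std_verts (Suc s) t"
    unfolding image_Un gV by (auto simp: std_verts_def lessThan_Suc)
  moreover have "map_prod ?g ?g ` link E r {} b = std_edges (Suc s) t"
    unfolding link_image gE gr by (auto simp: link_def std_edges_def lessThan_Suc)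
  ultimately show ?case using gr by blast
next
  case (long_leg V E r s t b c)
  then obtain f where f: "inj_on f V" "f ` V = std_verts s t" "map_prod f f ` E = std_edges s t"
    "f r = (0, 0)" by blast
  note rt = spider_rtree[OF long_leg.hyps(1)]
  let ?g = "f(b := (2, t), c := (3, t))"
  have eq: "?g v = f v" if "v \<in> V" for v using that long_leg.hyps(2,3) by auto
  have gV: "?g ` V = std_verts s t" using eq f(2) by (simp cong: image_cong)
  have gE: "map_prod ?g ?g ` E = std_edges s t"
    unfolding f(3)[symmetric] using eq rtree_edges[OF rt] by (intro image_cong) auto
  have gr: "?g r = (0, 0)" using eq rtree_root[OF rt] f(4) by simp
  have gbc: "?g b = (2, t)" "?g c = (3, t)" using long_leg.hyps(4) by auto
  have "inj_on ?g V" using f(1) eq by (simp cong: inj_on_cong)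
  moreover have "?g ` V \<inter> ?g ` {b, c} = {}"
    unfolding gV image_insert gbc image_empty by (auto simp: std_verts_def)
  moreover have "inj_on ?g {b, c}" using long_leg.hyps(4) by auto
  ultimately have "inj_on ?g (V \<union> {b, c})" by (intro inj_on_Un_disjoint_images)
  moreover have "?g ` (V \<union> {b, c}) = std_verts s (Suc t)"
    unfolding image_Un gV image_insert gbc image_empty by (auto simp: std_verts_def lessThan_Suc)
  moreover have "map_prod ?g ?g ` link E r {(b, c), (c, b)} b = std_edges s (Suc t)"
    unfolding link_image gE gr image_insert map_prod_simp gbc image_empty
    by (auto simp: link_def std_edges_def lessThan_Suc)
  ultimately show ?case using gr by blast
qed

lemma spider_iso:
  fixes G :: "'a pair_pre_digraph" and H :: "'b pair_pre_digraph"
  assumes "pair_wf_digraph G" "pair_wf_digraph H"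
    and "spider (pverts G) (parcs G) r s t" "spider (pverts H) (parcs H) r' s t"
  shows "digraph_iso G H"
proof -
  let ?S = "\<lparr>pverts = std_verts s t, parcs = std_edges s t\<rparr>"
  have "digraph_iso G ?S" "digraph_iso H ?S"
    using spider_standard_form[OF assms(3)] spider_standard_form[OF assms(4)]
    unfolding digraph_iso_iff[OF assms(1)] digraph_iso_iff[OF assms(2)] by simp_all metis+
  moreover have "wf_digraph (with_proj H)"
    using assms(2) by (rule wf_digraph_wp_iff[THEN iffD2])
  ultimately show ?thesis using digraph_iso_swap digraph_iso_trans by blast
qed

section \<open>Clique stars as spiders\<close>

lemma clique_union_snoc:
  "pverts (clique_union (ss @ [x])) = pverts (clique_union ss) \<union> Pair (length ss) ` {..<x}"
  "parcs (clique_union (ss @ [x])) = parcs (clique_union ss) \<union>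
    {((length ss, i), (length ss, j)) | i j. i < x \<and> j < x \<and> i \<noteq> j}"
  by (auto simp: clique_union_def nth_append less_Suc_eq)

text \<open>Every clique of order one or two in the list becomes a leg at \<open>(0, 0)\<close>. For
  \<open>r = 2\<close> the second vertex of the central clique is one more short leg, which explains
  \<open>r - 1\<close>.\<close>

lemma spider_clique_star:
  assumes "r \<in> {1, 2}" "set ss \<subseteq> {1, 2}"
  shows "spider (pverts (clique_star r ss)) (parcs (clique_star r ss)) (0, 0)
    (count_list ss 1 + (r - 1)) (count_list ss 2)"
  using assms(2)
\<comment> \<open>Components are appended at the end, since prepending would renumber the existing
  ones.\<close>
proof (induction ss rule: rev_induct)
  case Nil
  show ?case
  proof (cases "r = 1")
    case True
    then have "pverts (clique_star r []) = {(0, 0)}" "parcs (clique_star r []) = {}"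
      by (auto simp: clique_star_def clique_union_def)
    then show ?thesis using True spider.center by simp
  next
    case False
    then have "r = 2" using assms(1) by simp
    then have "pverts (clique_star r []) = {(0, 0)} \<union> {(0, 1)}"
      "parcs (clique_star r []) = link {} (0, 0) {} (0, 1)"
      by (auto simp: clique_star_def clique_union_def link_def)
    then show ?thesis using \<open>r = 2\<close> spider.short_leg[OF spider.center, of "(0, Suc 0)" "(0, 0)"]
      by simp
  qed
next
  case (snoc x ss)
  let ?k = "Suc (length ss)"
  have IH: "spider (pverts (clique_star r ss)) (parcs (clique_star r ss)) (0, 0)
    (count_list ss 1 + (r - 1)) (count_list ss 2)" using snoc by simp
  have new: "(?k, j) \<notin> pverts (clique_star r ss)" for j
    by (simp add: clique_star_def clique_union_def)
  have V: "pverts (clique_star r (ss @ [x])) = pverts (clique_star r ss) \<union> Pair ?k ` {..<x}"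
    using clique_union_snoc(1)[of "r # ss" x] by (simp add: clique_star_def)
  have "{((0, 0), (i, 0)) | i. 1 \<le> i \<and> i \<le> ?k} =
      {((0, 0), (i, 0)) | i. 1 \<le> i \<and> i \<le> length ss} \<union> {((0, 0), (?k, 0))}"
    "{((i, 0), (0, 0)) | i. 1 \<le> i \<and> i \<le> ?k} =
      {((i, 0), (0, 0)) | i. 1 \<le> i \<and> i \<le> length ss} \<union> {((?k, 0), (0, 0))}"
    by (auto simp: le_Suc_eq)
  then have E: "parcs (clique_star r (ss @ [x])) =
    link (parcs (clique_star r ss)) (0, 0) {((?k, i), (?k, j)) | i j. i < x \<and> j < x \<and> i \<noteq> j} (?k, 0)"
    using clique_union_snoc(2)[of "r # ss" x] unfolding link_def clique_star_def by auto
  consider "x = 1" | "x = 2" using snoc.prems by auto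
  then show ?case
  proof cases
    case 1
    then have "Pair ?k ` {..<x} = {(?k, 0)}" "{((?k, i), (?k, j)) | i j. i < x \<and> j < x \<and> i \<noteq> j} = {}"
      by auto
    then show ?thesis unfolding V E using spider.short_leg[OF IH new] 1 by simp
  next
    case 2
    then have "Pair ?k ` {..<x} = {(?k, 0), (?k, 1)}"
      "{((?k, i), (?k, j)) | i j. i < x \<and> j < x \<and> i \<noteq> j} = {((?k, 0), (?k, 1)), ((?k, 1), (?k, 0))}"
      by (auto simp: less_2_cases_iff)
    then show ?thesis unfolding V E using spider.long_leg[OF IH new new] 2 by simp
  qed
qed

section \<open>The extremal spiders\<close>

lemma count_list_replicate: "count_list (replicate k x) y = (if x = y then k else 0)"
  by (induction k) auto

lemma spider_F_graph:
  "odd n \<Longrightarrow> spider (pverts (F_graph n)) (parcs (F_graph n)) (0, 0) 0 ((n - 1) div 2)"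
  "even n \<Longrightarrow> spider (pverts (F_graph n)) (parcs (F_graph n)) (0, 0) 1 ((n - 2) div 2)"
  using spider_clique_star[of 1 "replicate ((n - 1) div 2) 2"]
    spider_clique_star[of 2 "replicate ((n - 2) div 2) 2"]
  by (auto simp: F_graph_def count_list_replicate set_replicate_conv_if)

lemma spider_T_graph:
  "odd n \<Longrightarrow> spider (pverts (T_graph n)) (parcs (T_graph n)) (0, 0) 2 ((n - 3) div 2)"
  "even n \<Longrightarrow> spider (pverts (T_graph n)) (parcs (T_graph n)) (0, 0) 3 ((n - 4) div 2)"
  using spider_clique_star[of 1 "replicate 2 1 @ replicate ((n - 3) div 2) 2"]
    spider_clique_star[of 1 "replicate 3 1 @ replicate ((n - 4) div 2) 2"]
  by (auto simp: T_graph_def count_list_replicate set_replicate_conv_if)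

text \<open>Replacing two short legs by one long leg keeps the order and, with \<open>s\<close>
  short legs left, compares \<open>2 * s + t + 6\<close> with twice \<open>2 * s + t + 3\<close>;
  the difference \<open>2 * s + t\<close> is positive. The induction makes \<open>k\<close> such
  trades.\<close>

lemma trade_short_legs:
  fixes s t k :: nat
  assumes "1 \<le> s" "1 \<le> k"
  shows "(2 * (s + 2 * k) + t + 2) * 2 ^ t < (2 * s + (t + k) + 2) * 2 ^ (t + k)"
  using assms(2)
proof (induction k arbitrary: t rule: dec_induct)
  case base
  have "2 * (s + 2 * 1) + t + 2 < (2 * s + (t + 1) + 2) * 2" using assms(1) by simp
  then show ?case by auto
next
  case (step k)
  have "2 * (s + 2 * Suc k) + t + 2 < (2 * (s + 2 * k) + (t + 1) + 2) * 2" using assms(1) by simp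
  then have "(2 * (s + 2 * Suc k) + t + 2) * 2 ^ t < (2 * (s + 2 * k) + (t + 1) + 2) * 2 ^ (t + 1)"
    by auto
  also have "\<dots> < (2 * s + (t + 1 + k) + 2) * 2 ^ (t + 1 + k)" by (rule step.IH)
  finally show ?case by simp
qed

text \<open>Up to the factor 2, \<open>h n\<close> is the count of \<open>card_dsets_spider\<close>
  at the leg numbers of \<open>T_graph n\<close>: two short legs for odd and three for even
  \<open>n\<close>.\<close>

lemma double_h:
  assumes "9 \<le> n"
  shows "odd n \<Longrightarrow> 2 * h n = 2 ^ n + (2 * 2 + (n - 3) div 2 + 2) * 2 ^ ((n - 3) div 2)"
    and "even n \<Longrightarrow> 2 * h n = 2 ^ n + (2 * 3 + (n - 4) div 2 + 2) * 2 ^ ((n - 4) div 2)"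
proof -
  assume "odd n"
  then obtain m where "n = 2 * m + 1" by (elim oddE)
  \<comment> \<open>With this \<open>t\<close> the exponent \<open>(n - 7) div 2\<close> in
    \<open>h\<close> is \<open>t\<close> itself, so no truncated subtraction remains.\<close>
  moreover define t where "t = m - 3"
  ultimately have "n = 2 * t + 7" using assms by simp
  then show "2 * h n = 2 ^ n + (2 * 2 + (n - 3) div 2 + 2) * 2 ^ ((n - 3) div 2)"
    by (simp add: h_def power_add algebra_simps)
next
  assume "even n"
  then obtain m where "n = 2 * m" by (elim evenE)
  moreover define t where "t = m - 4"
  ultimately have "n = 2 * t + 8" using assms by simp
  then show "2 * h n = 2 ^ n + (2 * 3 + (n - 4) div 2 + 2) * 2 ^ ((n - 4) div 2)"
    by (simp add: h_def power_add algebra_simps)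
qed

lemma card_dsets_spider_extremal:
  assumes "spider V E r s t" "card V = n" "9 \<le> n" "s \<in> {2, 3}"
  shows "card (dsets V E) = h n"
proof -
  have n: "n = Suc (s + 2 * t)" using card_spider[OF assms(1)] assms(2) by simp
  have "2 * card (dsets V E) = 2 ^ n + (2 * s + t + 2) * 2 ^ t"
    using card_dsets_spider[OF assms(1)] unfolding n .
  also have "\<dots> = 2 * h n" using assms(4) double_h[OF assms(3)] n by (auto simp: algebra_simps)
  finally show ?thesis by simp
qed

lemma card_dsets_spider_less:
  assumes "spider V E r s t" "card V = n" "9 \<le> n" "4 \<le> s"
  shows "card (dsets V E) < h n"
proof -
  have n: "n = Suc (s + 2 * t)" using card_spider[OF assms(1)] assms(2) by simp
  \<comment> \<open>\<open>s0\<close> is the number of short legs of \<open>T_graph n\<close>.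
    Parity makes the surplus \<open>s - s0\<close> even, and trading it for \<open>k\<close> long
    legs leads to the leg numbers of \<open>T_graph n\<close>.\<close>
  define s0 where "s0 = (if odd n then 2 else 3 :: nat)"
  define k where "k = (s - s0) div 2"
  have "odd n \<longleftrightarrow> even s" using n by simp
  then have s: "s = s0 + 2 * k" "1 \<le> k"
    using assms(4) unfolding s0_def k_def by presburger+
  have t: "t + k = (if odd n then (n - 3) div 2 else (n - 4) div 2)"
    using n s by (auto simp: s0_def)
  have "2 * card (dsets V E) = 2 ^ n + (2 * (s0 + 2 * k) + t + 2) * 2 ^ t"
    using card_dsets_spider[OF assms(1)] unfolding n s(1) by simp
  also have "\<dots> < 2 ^ n + (2 * s0 + (t + k) + 2) * 2 ^ (t + k)"
    using trade_short_legs[of s0 k t] s(2) by (simp add: s0_def)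
  also have "\<dots> = 2 * h n"
    using double_h[OF assms(3)] unfolding t s0_def by presburger
  finally show ?thesis by simp
qed

theorem theorem3p2:
  fixes T :: "'a pair_pre_digraph" and n :: nat
  assumes "pair_graph T"
    and "undirected_tree T"
    and "card (pverts T) = n"
    and "9 \<le> n"
    and "\<not> digraph_iso T (F_graph n)"
  shows "num_dissociation_sets T \<le> h n
    \<and> (num_dissociation_sets T = h n \<longleftrightarrow> digraph_iso T (T_graph n))"
proof -
  let ?V = "pverts T" and ?E = "parcs T"
  have wf: "pair_wf_digraph T" "pair_wf_digraph (F_graph n)" "pair_wf_digraph (T_graph n)"
    using assms(1) pair_graph_F_graph pair_graph_T_graph
    by (auto simp: pair_graph_def pair_digraph_def pair_fin_digraph_def)
  have iso: "card (dsets ?V ?E) = h n" if "digraph_iso T (T_graph n)"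
  proof -
    have "digraph_iso (T_graph n) T"
      using that wf(1) digraph_iso_swap wf_digraph_wp_iff by blast
    then obtain f where f: "inj_on f (pverts (T_graph n))" "?V = f ` pverts (T_graph n)"
      "?E = map_prod f f ` parcs (T_graph n)"
      unfolding digraph_iso_iff[OF wf(3)] by (elim exE conjE)
    obtain s t where s: "spider (pverts (T_graph n)) (parcs (T_graph n)) (0, 0) s t" "s \<in> {2, 3}"
      using spider_T_graph[of n] by (cases "odd n") auto
    have "spider ?V ?E (f (0, 0)) s t" unfolding f(2,3) by (rule spider_image[OF s(1) f(1)])
    then show ?thesis using assms(3,4) s(2) by (rule card_dsets_spider_extremal)
  qed
  obtain r where r: "rtree ?V ?E r" using undirected_tree_rtree[OF assms(1,2)] by blast
  have "7 \<le> card ?V" using assms(3,4) by simp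
  then consider v s t where "spider ?V ?E v s t" | v where "broad ?V ?E v"
    using spider_or_broad[OF r] by blast
  \<comment> \<open>This disjunction gives the bound at once and shows that equality forces an
    isomorphism; \<open>iso\<close> supplies the converse.\<close>
  then have "card (dsets ?V ?E) < h n \<or> card (dsets ?V ?E) = h n \<and> digraph_iso T (T_graph n)"
  proof cases
    case (1 v s t)
    have n: "n = Suc (s + 2 * t)" using card_spider[OF 1] assms(3) by simp
    \<comment> \<open>With at most one short leg, parity leaves exactly the leg numbers of
      \<open>F_graph n\<close>.\<close>
    have "2 \<le> s"
    proof (rule ccontr)
      assume "\<not> 2 \<le> s"
      then have "s = 0 \<or> s = 1" by linarith
      then have "odd n \<and> s = 0 \<and> t = (n - 1) div 2 \<or> even n \<and> s = 1 \<and> t = (n - 2) div 2"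
        using n by auto
      then have "spider (pverts (F_graph n)) (parcs (F_graph n)) (0, 0) s t"
        using spider_F_graph[of n] by auto
      then show False using spider_iso[OF wf(1,2) 1] assms(5) by blast
    qed
    show ?thesis
    proof (cases "4 \<le> s")
      case True
      then show ?thesis using card_dsets_spider_less[OF 1 assms(3,4)] by blast
    next
      case False
      then have "s = 2 \<or> s = 3" using \<open>2 \<le> s\<close> by linarith
      then have "odd n \<and> s = 2 \<and> t = (n - 3) div 2 \<or> even n \<and> s = 3 \<and> t = (n - 4) div 2"
        using n by auto
      then have "spider (pverts (T_graph n)) (parcs (T_graph n)) (0, 0) s t"
        using spider_T_graph[of n] by auto
      then have "digraph_iso T (T_graph n)" using spider_iso[OF wf(1,3) 1] by blast
      then show ?thesis using iso by blast
    qed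
  next
    case (2 v)
    have "total (root_counts ?V ?E v) < h n"
      using broad_broad_profile[OF 2] assms(4) unfolding assms(3) by (rule broad_total_less_h)
    then show ?thesis using total_root_counts[OF rtree_finite[OF r]] by simp
  qed
  then show ?thesis using iso unfolding num_dissociation_sets_eq by auto
qed

end
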